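(* Let $\mathbb{X}$ be a semi-abelian category. For each $n\in\mathbb{Z}$ the triplet of full subcategories $$(chn(\mathbb{X})_{n-1\geq},\;chn(\mathbb{X})_{\geq n},\;\mathcal{F}_{\mathbf{tr}_{n-1}})$$ is a TTF theory in $chn(\mathbb{X})$. Moreover, by restriction this determines the TTF theory in $pch(\mathbb{X})$ $$(pch(\mathbb{X})_{n-1\geq},\;pch(\mathbb{X})_{\geq n},\;\mathcal{MN}_n).$$ Similarly, the triplet of subcategories of $chn(\mathbb{X})$ $$(Ker(\mathbf{cot}_{n-1}),\;chn(\mathbb{X})_{n-1\geq},\;chn(\mathbb{X})_{\geq n})$$ determines (by restriction to $pch(\mathbb{X})$) the TTF theory in $pch(\mathbb{X})$ $$(\mathcal{EP}_n,\;pch(\mathbb{X})_{n-1\geq},\;pch(\mathbb{X})_{\geq n}).$$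
   Context: A torsion theory in a pointed category is a pair $(\mathcal{T},\mathcal{F})$ of full replete subcategories such that every morphism from an object of $\mathcal{T}$ to an object of $\mathcal{F}$ is zero, and every object $X$ admits a short exact sequence $0\to T_X\to X\to F_X\to0$ with $T_X\in\mathcal{T}$, $F_X\in\mathcal{F}$. A torsion torsion-free theory (TTF theory) is a triplet $(\mathcal{C},\mathcal{T},\mathcal{F})$ of full subcategories such that $(\mathcal{C},\mathcal{T})$ and $(\mathcal{T},\mathcal{F})$ are torsion theories. $chn(\mathbb{X})$ is the category of ($\mathbb{Z}$-indexed) chain complexes $\delta_n:M_n\to M_{n-1}$, $\delta_n\delta_{n+1}=0$, in $\mathbb{X}$. A chain complex is proper if, for each $\delta_n$, the monomorphism in its (normal epi, mono) factorization is a normal monomorphism; $pch(\mathbb{X})$ is the full subcategory of proper chain complexes. The subscript $n\geq$ (resp. $\geq n$) denotes the full subcategory of complexes with $M_i=0$ for $i>n$ (resp. $i<n$). $\mathbf{tr}_n:chn(\mathbb{X})\to chn(\mathbb{X})_{n\geq}$ is truncation (forgetting degrees $>n$); its right adjoint $\mathbf{cosk}_n$ sends $M$ to $\dots\to0\to\ker(\delta_n)\to M_n\to M_{n-1}\to\cdots$. $\mathbf{cot}_n:chn(\mathbb{X})\to chn(\mathbb{X})_{n\geq}$ sends $M$ to $Coker(\delta_{n+1})\to M_{n-1}\to M_{n-2}\to\cdots$ (left adjoint of the inclusion), and $Ker(\mathbf{cot}_n)$ is the full subcategory of $M$ with $\mathbf{cot}_n(M)=0$. $\mathcal{F}_{\mathbf{tr}_{n-1}}$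 is the full subcategory of chain complexes whose component $M\to\mathbf{cosk}_{n-1}\mathbf{tr}_{n-1}(M)$ of the unit is monic. $\mathcal{MN}_n$ is the full subcategory of proper chain complexes with $M_i=0$ for $i>n$ and $\delta_n$ monic. $\mathcal{EP}_n$ is the full subcategory of proper chain complexes with $M_i=0$ for $i<n-1$ and $\delta_n$ epic. *)

theory Defs
  imports Main
begin

section \<open>Categories\<close>

text \<open>A category is given by a set of objects and a set of arrows, each arrow carrying its domain and
  codomain. Composition \<open>g \<cdot>\<^bsub>C\<^esub> f\<close> is written in applicative order and is meaningful only when
  \<open>Dom C g = Cod C f\<close>. A full subcategory is identified with its set of objects.\<close>

record ('o, 'm) cat =
  Obj :: "'o set"
  Arr :: "'m set"
  Dom :: "'m \<Rightarrow> 'o"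
  Cod :: "'m \<Rightarrow> 'o"
  Idn :: "'o \<Rightarrow> 'm"
  Comp :: "'m \<Rightarrow> 'm \<Rightarrow> 'm"  (infixr "\<cdot>\<index>" 70)

definition hom :: "('o, 'm) cat \<Rightarrow> 'o \<Rightarrow> 'o \<Rightarrow> 'm set" where
  "hom C A B = {f \<in> Arr C. Dom C f = A \<and> Cod C f = B}"

locale category =
  fixes C :: "('o, 'm) cat" (structure)
  assumes Dom_Obj: "f \<in> Arr C \<Longrightarrow> Dom C f \<in> Obj C"
    and Cod_Obj: "f \<in> Arr C \<Longrightarrow> Cod C f \<in> Obj C"
    and Idn_hom: "A \<in> Obj C \<Longrightarrow> Idn C A \<in> hom C A A"
    and Comp_hom: "\<lbrakk>f \<in> hom C A B; g \<in> hom C B D\<rbrakk> \<Longrightarrow> g \<cdot> f \<in> hom C A D"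
    and Comp_Idn: "f \<in> hom C A B \<Longrightarrow> f \<cdot> Idn C A = f"
    and Idn_Comp: "f \<in> hom C A B \<Longrightarrow> Idn C B \<cdot> f = f"
    and Comp_assoc: "\<lbrakk>f \<in> hom C A B; g \<in> hom C B D; h \<in> hom C D E\<rbrakk>
      \<Longrightarrow> (h \<cdot> g) \<cdot> f = h \<cdot> (g \<cdot> f)"

definition full_subcat :: "('o, 'm) cat \<Rightarrow> 'o set \<Rightarrow> ('o, 'm) cat" where
  "full_subcat C S =
     C\<lparr>Obj := Obj C \<inter> S, Arr := {f \<in> Arr C. Dom C f \<in> S \<and> Cod C f \<in> S}\<rparr>"

definition monic :: "('o, 'm) cat \<Rightarrow> 'm \<Rightarrow> bool" where
  "monic C m \<longleftrightarrow> m \<in> Arr C \<and>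
     (\<forall>D. \<forall>u \<in> hom C D (Dom C m). \<forall>v \<in> hom C D (Dom C m). m \<cdot>\<^bsub>C\<^esub> u = m \<cdot>\<^bsub>C\<^esub> v \<longrightarrow> u = v)"

definition epic :: "('o, 'm) cat \<Rightarrow> 'm \<Rightarrow> bool" where
  "epic C e \<longleftrightarrow> e \<in> Arr C \<and>
     (\<forall>D. \<forall>u \<in> hom C (Cod C e) D. \<forall>v \<in> hom C (Cod C e) D. u \<cdot>\<^bsub>C\<^esub> e = v \<cdot>\<^bsub>C\<^esub> e \<longrightarrow> u = v)"

definition iso :: "('o, 'm) cat \<Rightarrow> 'm \<Rightarrow> bool" where
  "iso C f \<longleftrightarrow> f \<in> Arr C \<and>
     (\<exists>g \<in> hom C (Cod C f) (Dom C f).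
        g \<cdot>\<^bsub>C\<^esub> f = Idn C (Dom C f) \<and> f \<cdot>\<^bsub>C\<^esub> g = Idn C (Cod C f))"

definition replete :: "('o, 'm) cat \<Rightarrow> 'o set \<Rightarrow> bool" where
  "replete C S \<longleftrightarrow> (\<forall>f. iso C f \<and> Dom C f \<in> S \<longrightarrow> Cod C f \<in> S)"

definition pullback :: "('o, 'm) cat \<Rightarrow> 'm \<Rightarrow> 'm \<Rightarrow> 'm \<Rightarrow> 'm \<Rightarrow> bool" where
  "pullback C f g p q \<longleftrightarrow>
     f \<in> Arr C \<and> g \<in> Arr C \<and> Cod C f = Cod C g \<and>
     p \<in> hom C (Dom C p) (Dom C f) \<and> q \<in> hom C (Dom C p) (Dom C g) \<and> f \<cdot>\<^bsub>C\<^esub> p = g \<cdot>\<^bsub>C\<^esub> q \<and>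
     (\<forall>D. \<forall>a \<in> hom C D (Dom C f). \<forall>b \<in> hom C D (Dom C g). f \<cdot>\<^bsub>C\<^esub> a = g \<cdot>\<^bsub>C\<^esub> b \<longrightarrow>
        (\<exists>!u. u \<in> hom C D (Dom C p) \<and> p \<cdot>\<^bsub>C\<^esub> u = a \<and> q \<cdot>\<^bsub>C\<^esub> u = b))"

definition coequalizer :: "('o, 'm) cat \<Rightarrow> 'm \<Rightarrow> 'm \<Rightarrow> 'm \<Rightarrow> bool" where
  "coequalizer C f g q \<longleftrightarrow>
     f \<in> Arr C \<and> g \<in> hom C (Dom C f) (Cod C f) \<and>
     q \<in> hom C (Cod C f) (Cod C q) \<and> q \<cdot>\<^bsub>C\<^esub> f = q \<cdot>\<^bsub>C\<^esub> g \<and>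
     (\<forall>D. \<forall>h \<in> hom C (Cod C f) D. h \<cdot>\<^bsub>C\<^esub> f = h \<cdot>\<^bsub>C\<^esub> g \<longrightarrow>
        (\<exists>!u. u \<in> hom C (Cod C q) D \<and> u \<cdot>\<^bsub>C\<^esub> q = h))"

definition coproduct :: "('o, 'm) cat \<Rightarrow> 'o \<Rightarrow> 'o \<Rightarrow> 'm \<Rightarrow> 'm \<Rightarrow> bool" where
  "coproduct C A B i j \<longleftrightarrow>
     i \<in> hom C A (Cod C i) \<and> j \<in> hom C B (Cod C i) \<and>
     (\<forall>D. \<forall>f \<in> hom C A D. \<forall>g \<in> hom C B D.
        (\<exists>!u. u \<in> hom C (Cod C i) D \<and> u \<cdot>\<^bsub>C\<^esub> i = f \<and> u \<cdot>\<^bsub>C\<^esub> j = g))"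

definition regular_epi :: "('o, 'm) cat \<Rightarrow> 'm \<Rightarrow> bool" where
  "regular_epi C q \<longleftrightarrow> (\<exists>f g. coequalizer C f g q)"


section \<open>Pointed categories and torsion theories\<close>

definition zero_obj :: "('o, 'm) cat \<Rightarrow> 'o \<Rightarrow> bool" where
  "zero_obj C Z \<longleftrightarrow> Z \<in> Obj C \<and>
     (\<forall>A \<in> Obj C. (\<exists>!f. f \<in> hom C A Z) \<and> (\<exists>!f. f \<in> hom C Z A))"

locale pointed_category = category +
  assumes ex_zero: "\<exists>Z. zero_obj C Z"

definition zero_arr :: "('o, 'm) cat \<Rightarrow> 'm \<Rightarrow> bool" where
  "zero_arr C f \<longleftrightarrow> f \<in> Arr C \<and>
     (\<exists>Z. zero_obj C Z \<and> (\<exists>g \<in> hom C (Dom C f) Z. \<exists>h \<in> hom C Z (Cod C f). f = h \<cdot>\<^bsub>C\<^esub> g))"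

definition is_kernel :: "('o, 'm) cat \<Rightarrow> 'm \<Rightarrow> 'm \<Rightarrow> bool" where
  "is_kernel C f k \<longleftrightarrow>
     f \<in> Arr C \<and> k \<in> hom C (Dom C k) (Dom C f) \<and> zero_arr C (f \<cdot>\<^bsub>C\<^esub> k) \<and>
     (\<forall>D. \<forall>h \<in> hom C D (Dom C f). zero_arr C (f \<cdot>\<^bsub>C\<^esub> h) \<longrightarrow>
        (\<exists>!u. u \<in> hom C D (Dom C k) \<and> k \<cdot>\<^bsub>C\<^esub> u = h))"

definition is_cokernel :: "('o, 'm) cat \<Rightarrow> 'm \<Rightarrow> 'm \<Rightarrow> bool" where
  "is_cokernel C f q \<longleftrightarrow>
     f \<in> Arr C \<and> q \<in> hom C (Cod C f) (Cod C q) \<and> zero_arr C (q \<cdot>\<^bsub>C\<^esub> f) \<and>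
     (\<forall>D. \<forall>h \<in> hom C (Cod C f) D. zero_arr C (h \<cdot>\<^bsub>C\<^esub> f) \<longrightarrow>
        (\<exists>!u. u \<in> hom C (Cod C q) D \<and> u \<cdot>\<^bsub>C\<^esub> q = h))"

definition normal_mono :: "('o, 'm) cat \<Rightarrow> 'm \<Rightarrow> bool" where
  "normal_mono C k \<longleftrightarrow> (\<exists>f. is_kernel C f k)"

definition normal_epi :: "('o, 'm) cat \<Rightarrow> 'm \<Rightarrow> bool" where
  "normal_epi C q \<longleftrightarrow> (\<exists>f. is_cokernel C f q)"

definition short_exact :: "('o, 'm) cat \<Rightarrow> 'm \<Rightarrow> 'm \<Rightarrow> bool" where
  "short_exact C k p \<longleftrightarrow> is_kernel C p k \<and> is_cokernel C k p"

definition torsion_theory :: "('o, 'm) cat \<Rightarrow> 'o set \<Rightarrow> 'o set \<Rightarrow> bool" where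
  "torsion_theory C T F \<longleftrightarrow> pointed_category C \<and>
     T \<subseteq> Obj C \<and> F \<subseteq> Obj C \<and> replete C T \<and> replete C F \<and>
     (\<forall>A \<in> T. \<forall>B \<in> F. \<forall>f \<in> hom C A B. zero_arr C f) \<and>
     (\<forall>X \<in> Obj C. \<exists>A \<in> T. \<exists>B \<in> F. \<exists>k \<in> hom C A X. \<exists>p \<in> hom C X B. short_exact C k p)"

definition ttf_theory :: "('o, 'm) cat \<Rightarrow> 'o set \<times> 'o set \<times> 'o set \<Rightarrow> bool" where
  "ttf_theory C = (\<lambda>(S, T, F). torsion_theory C S T \<and> torsion_theory C T F)"

text \<open>\<open>restriction D\<close> intersects each member of a triple of full subcategories of an ambient category with its full
  subcategory \<open>D\<close>.\<close>

definition restriction ::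
    "('o, 'm) cat \<Rightarrow> 'o set \<times> 'o set \<times> 'o set \<Rightarrow> 'o set \<times> 'o set \<times> 'o set" where
  "restriction D = (\<lambda>(S, T, F). (S \<inter> Obj D, T \<inter> Obj D, F \<inter> Obj D))"


section \<open>Semi-abelian categories\<close>

text \<open>An internal equivalence relation \<open>r\<^sub>1, r\<^sub>2 : R \<rightarrow> A\<close>; the pullback in the transitivity clause is
  the object of pairs of composable pairs.\<close>

definition equivalence_relation :: "('o, 'm) cat \<Rightarrow> 'm \<Rightarrow> 'm \<Rightarrow> bool" where
  "equivalence_relation C r1 r2 \<longleftrightarrow>
     (let R = Dom C r1; A = Cod C r1 in
       r1 \<in> Arr C \<and> r2 \<in> hom C R A \<and>
       (\<forall>D. \<forall>u \<in> hom C D R. \<forall>v \<in> hom C D R.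
          r1 \<cdot>\<^bsub>C\<^esub> u = r1 \<cdot>\<^bsub>C\<^esub> v \<and> r2 \<cdot>\<^bsub>C\<^esub> u = r2 \<cdot>\<^bsub>C\<^esub> v \<longrightarrow> u = v) \<and>
       (\<exists>s \<in> hom C A R. r1 \<cdot>\<^bsub>C\<^esub> s = Idn C A \<and> r2 \<cdot>\<^bsub>C\<^esub> s = Idn C A) \<and>
       (\<exists>t \<in> hom C R R. r1 \<cdot>\<^bsub>C\<^esub> t = r2 \<and> r2 \<cdot>\<^bsub>C\<^esub> t = r1) \<and>
       (\<forall>p q. pullback C r2 r1 p q \<longrightarrow>
          (\<exists>t \<in> hom C (Dom C p) R. r1 \<cdot>\<^bsub>C\<^esub> t = r1 \<cdot>\<^bsub>C\<^esub> p \<and> r2 \<cdot>\<^bsub>C\<^esub> t = r2 \<cdot>\<^bsub>C\<^esub> q)))"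

text \<open>Finite completeness is expressed by pullbacks together with the terminal object given by
  pointedness; kernel pairs are pullbacks of an arrow along itself.\<close>

locale barr_exact_pointed = pointed_category +
  assumes ex_pullback:
      "\<lbrakk>f \<in> Arr C; g \<in> Arr C; Cod C f = Cod C g\<rbrakk> \<Longrightarrow> \<exists>p q. pullback C f g p q"
    and ex_coequalizer_kernel_pair: "pullback C f f p q \<Longrightarrow> \<exists>e. coequalizer C p q e"
    and regular_epi_stable: "\<lbrakk>pullback C f g p q; regular_epi C f\<rbrakk> \<Longrightarrow> regular_epi C q"
    and effective: "equivalence_relation C r1 r2 \<Longrightarrow> \<exists>f. pullback C f f r1 r2"

text \<open>A point over \<open>B\<close> is a split epimorphism \<open>p : A \<rightarrow> B\<close> with a chosen section \<open>s\<close>.\<close>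

definition point :: "('o, 'm) cat \<Rightarrow> 'o \<Rightarrow> 'o \<Rightarrow> 'm \<Rightarrow> 'm \<Rightarrow> bool" where
  "point C A B p s \<longleftrightarrow> p \<in> hom C A B \<and> s \<in> hom C B A \<and> p \<cdot>\<^bsub>C\<^esub> s = Idn C B"

text \<open>Protomodularity: the change-of-base functors of the fibration of points reflect isomorphisms.
  Here \<open>f\<close> is a morphism of points over \<open>B\<close>, and \<open>g\<close> is its image under pulling back
  along \<open>v : E \<rightarrow> B\<close>; that \<open>g\<close> is compatible with the induced sections is automatic.\<close>

locale semi_abelian = barr_exact_pointed +
  assumes ex_coproduct: "\<lbrakk>A \<in> Obj C; B \<in> Obj C\<rbrakk> \<Longrightarrow> \<exists>i j. coproduct C A B i j"
    and protomodular:
      "\<lbrakk>point C A B p s; point C A' B p' s';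
        f \<in> hom C A A'; p' \<cdot> f = p; f \<cdot> s = s';
        v \<in> hom C E B; pullback C p v x y; pullback C p' v x' y';
        g \<in> hom C (Dom C x) (Dom C x'); x' \<cdot> g = f \<cdot> x; y' \<cdot> g = y;
        iso C g\<rbrakk> \<Longrightarrow> iso C f"


section \<open>Chain complexes\<close>

datatype ('o, 'm) chain = Chain (ob: "int \<Rightarrow> 'o") (bd: "int \<Rightarrow> 'm")

datatype ('o, 'm) chain_map =
  ChainMap (src: "('o, 'm) chain") (cmp: "int \<Rightarrow> 'm") (tgt: "('o, 'm) chain")

definition chain_complex :: "('o, 'm) cat \<Rightarrow> ('o, 'm) chain \<Rightarrow> bool" where
  "chain_complex X M \<longleftrightarrow>
     (\<forall>i. ob M i \<in> Obj X \<and> bd M i \<in> hom X (ob M i) (ob M (i - 1)) \<and>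
          zero_arr X (bd M i \<cdot>\<^bsub>X\<^esub> bd M (i + 1)))"

definition is_chain_map :: "('o, 'm) cat \<Rightarrow> ('o, 'm) chain_map \<Rightarrow> bool" where
  "is_chain_map X f \<longleftrightarrow> chain_complex X (src f) \<and> chain_complex X (tgt f) \<and>
     (\<forall>i. cmp f i \<in> hom X (ob (src f) i) (ob (tgt f) i) \<and>
          cmp f (i - 1) \<cdot>\<^bsub>X\<^esub> bd (src f) i = bd (tgt f) i \<cdot>\<^bsub>X\<^esub> cmp f i)"

definition chn :: "('o, 'm) cat \<Rightarrow> (('o, 'm) chain, ('o, 'm) chain_map) cat" where
  "chn X = \<lparr>Obj = {M. chain_complex X M}, Arr = {f. is_chain_map X f},
     Dom = src, Cod = tgt,
     Idn = (\<lambda>M. ChainMap M (\<lambda>i. Idn X (ob M i)) M),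
     Comp = (\<lambda>g f. ChainMap (src f) (\<lambda>i. cmp g i \<cdot>\<^bsub>X\<^esub> cmp f i) (tgt g))\<rparr>"

text \<open>In a semi-abelian category the (normal epi, mono) factorization exists and is unique up to
  isomorphism, so it does not matter which one is inspected.\<close>

definition proper_chain :: "('o, 'm) cat \<Rightarrow> ('o, 'm) chain \<Rightarrow> bool" where
  "proper_chain X M \<longleftrightarrow> chain_complex X M \<and>
     (\<forall>i. \<exists>e m. normal_epi X e \<and> monic X m \<and> Cod X e = Dom X m \<and>
        bd M i = m \<cdot>\<^bsub>X\<^esub> e \<and> normal_mono X m)"

definition pch :: "('o, 'm) cat \<Rightarrow> (('o, 'm) chain, ('o, 'm) chain_map) cat" where
  "pch X = full_subcat (chn X) {M. proper_chain X M}"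

definition chn_le :: "('o, 'm) cat \<Rightarrow> int \<Rightarrow> ('o, 'm) chain set" where
  "chn_le X n = {M \<in> Obj (chn X). \<forall>i > n. zero_obj X (ob M i)}"

definition chn_ge :: "('o, 'm) cat \<Rightarrow> int \<Rightarrow> ('o, 'm) chain set" where
  "chn_ge X n = {M \<in> Obj (chn X). \<forall>i < n. zero_obj X (ob M i)}"

definition pch_le :: "('o, 'm) cat \<Rightarrow> int \<Rightarrow> ('o, 'm) chain set" where
  "pch_le X n = {M \<in> Obj (pch X). \<forall>i > n. zero_obj X (ob M i)}"

definition pch_ge :: "('o, 'm) cat \<Rightarrow> int \<Rightarrow> ('o, 'm) chain set" where
  "pch_ge X n = {M \<in> Obj (pch X). \<forall>i < n. zero_obj X (ob M i)}"

definition MN :: "('o, 'm) cat \<Rightarrow> int \<Rightarrow> ('o, 'm) chain set" where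
  "MN X n = {M \<in> Obj (pch X). (\<forall>i > n. zero_obj X (ob M i)) \<and> monic X (bd M n)}"

definition EP :: "('o, 'm) cat \<Rightarrow> int \<Rightarrow> ('o, 'm) chain set" where
  "EP X n = {M \<in> Obj (pch X). (\<forall>i < n - 1. zero_obj X (ob M i)) \<and> epic X (bd M n)}"


section \<open>Truncation, coskeleton and cotruncation\<close>

text \<open>The functors below are determined up to isomorphism; representatives are fixed by choosing a
  zero object, kernels and cokernels. Only their values on objects, and the unit of
  \<open>tr \<stileturn> cosk\<close>, are needed.\<close>

definition Zero :: "('o, 'm) cat \<Rightarrow> 'o" where
  "Zero C = (SOME Z. zero_obj C Z)"

definition zero_map :: "('o, 'm) cat \<Rightarrow> 'o \<Rightarrow> 'o \<Rightarrow> 'm" where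
  "zero_map C A B = (THE f. f \<in> hom C A B \<and> zero_arr C f)"

definition ker :: "('o, 'm) cat \<Rightarrow> 'm \<Rightarrow> 'm" where
  "ker C f = (SOME k. is_kernel C f k)"

definition coker :: "('o, 'm) cat \<Rightarrow> 'm \<Rightarrow> 'm" where
  "coker C f = (SOME q. is_cokernel C f q)"

text \<open>Complexes with prescribed differentials in degrees at most \<open>n\<close> and zero differentials above.\<close>

definition extend_by_zero ::
    "('o, 'm) cat \<Rightarrow> int \<Rightarrow> (int \<Rightarrow> 'o) \<Rightarrow> (int \<Rightarrow> 'm) \<Rightarrow> ('o, 'm) chain" where
  "extend_by_zero X n A d =
     (let B = (\<lambda>i. if i \<le> n then A i else Zero X) in
      Chain B (\<lambda>i. if i \<le> n then d i else zero_map X (B i) (B (i - 1))))"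

definition tr :: "('o, 'm) cat \<Rightarrow> int \<Rightarrow> ('o, 'm) chain \<Rightarrow> ('o, 'm) chain" where
  "tr X n M = extend_by_zero X n (ob M) (bd M)"

definition cosk :: "('o, 'm) cat \<Rightarrow> int \<Rightarrow> ('o, 'm) chain \<Rightarrow> ('o, 'm) chain" where
  "cosk X n M =
     (let k = ker X (bd M n) in
      extend_by_zero X (n + 1) ((ob M)(n + 1 := Dom X k)) ((bd M)(n + 1 := k)))"

text \<open>The component at \<open>M\<close> of the unit of \<open>tr \<stileturn> cosk\<close>: the chain map \<open>M \<rightarrow> cosk (tr M)\<close> whose
  truncation is the identity. In degree \<open>n + 1\<close> it is the factorization of \<open>\<delta>\<^bsub>n+1\<^esub>\<close>
  through the kernel of \<open>\<delta>\<^bsub>n\<^esub>\<close>.\<close>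

definition cosk_unit :: "('o, 'm) cat \<Rightarrow> int \<Rightarrow> ('o, 'm) chain \<Rightarrow> ('o, 'm) chain_map" where
  "cosk_unit X n M =
     (let k = ker X (bd M n) in
      ChainMap M
        (\<lambda>i. if i \<le> n then Idn X (ob M i)
             else if i = n + 1
               then (THE u. u \<in> hom X (ob M (n + 1)) (Dom X k) \<and> k \<cdot>\<^bsub>X\<^esub> u = bd M (n + 1))
             else zero_map X (ob M i) (Zero X))
        (cosk X n (tr X n M)))"

definition F_tr :: "('o, 'm) cat \<Rightarrow> int \<Rightarrow> ('o, 'm) chain set" where
  "F_tr X n = {M \<in> Obj (chn X). monic (chn X) (cosk_unit X n M)}"

definition cot :: "('o, 'm) cat \<Rightarrow> int \<Rightarrow> ('o, 'm) chain \<Rightarrow> ('o, 'm) chain" where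
  "cot X n M =
     (let c = coker X (bd M (n + 1)) in
      extend_by_zero X n ((ob M)(n := Cod X c))
        ((bd M)(n := (THE u. u \<in> hom X (Cod X c) (ob M (n - 1)) \<and> u \<cdot>\<^bsub>X\<^esub> c = bd M n))))"

definition Ker_cot :: "('o, 'm) cat \<Rightarrow> int \<Rightarrow> ('o, 'm) chain set" where
  "Ker_cot X n =
     {M \<in> Obj (chn X). zero_obj (full_subcat (chn X) (chn_le X n)) (cot X n M)}"

end

theory Submission
  imports Defs
begin

text \<open>
  Orthogonality in each torsion theory is read off degree by degree: a chain map between the two
  classes vanishes wherever its domain or its codomain is zero, and in the one degree, if any, where neither
  is, compatibility with the differential \<open>\<delta>\<^sub>n\<close> forces it to vanish because \<open>\<delta>\<^sub>n\<close> is monic in the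
  codomain or epic in the domain. The content is therefore the existence of the short exact sequences
  \<open>0 \<rightarrow> T \<rightarrow> M \<rightarrow> F \<rightarrow> 0\<close>, and these come from truncations:

  \<^item> splitting \<open>M\<close> between the degrees \<open>n - 1\<close> and \<open>n\<close> (lemma \<open>ex_brutal_truncation\<close>) gives the pair of
    complexes in degrees \<open>\<le> n - 1\<close> and complexes in degrees \<open>\<ge> n\<close>;
  \<^item> factor \<open>\<delta>\<^sub>n = m \<cdot> e\<close> with \<open>e\<close> a normal epimorphism and \<open>m\<close> monic. Cutting \<open>M\<^sub>n\<close> into the kernel of
    \<open>\<delta>\<^sub>n\<close> and the image \<open>I\<close> leaves the quotient \<open>I \<rightarrow> M\<^bsub>n-1\<^esub> \<rightarrow> \<dots>\<close>, whose top differential \<open>m\<close> is monic;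
  \<^item> if \<open>m\<close> is moreover normal, cutting \<open>M\<^bsub>n-1\<^esub>\<close> into \<open>I\<close> and the cokernel of \<open>\<delta>\<^sub>n\<close> leaves the
    subcomplex \<open>\<dots> \<rightarrow> M\<^sub>n \<rightarrow> I\<close>, whose bottom differential \<open>e\<close> is epic.

  The last two are instances of one construction (lemma \<open>ex_good_truncation\<close>). A degreewise short exact
  sequence whose subobjects are stable under the differential is short exact in the category of
  complexes (\<open>ex_short_exact_chn\<close>). In all three sequences every differential of the subcomplex and of
  the quotient either has a zero end or is obtained from a differential of \<open>M\<close> by removing a
  monomorphism on the left or a normal epimorphism on the right. Both operations preserve properness
  (\<open>proper_arrow_corestrict\<close>, \<open>proper_arrow_factor_epi\<close>), so the sequences restrict to proper complexes.

  Semi-abelianness enters through the (normal epi, mono) factorization. Barr exactness factors an arrow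
  as a coequalizer of its kernel pair followed by a monomorphism; protomodularity makes that coequalizer
  a cokernel (\<open>kernel_pair_identified\<close>). As a consequence normal monomorphisms have cokernels, which is
  what the third sequence needs.

  It remains to recognize the functorial descriptions. The unit \<open>M \<rightarrow> cosk tr M\<close> is monic exactly when
  it is monic in each degree, which says that \<open>M\<close> vanishes above \<open>n\<close> and \<open>\<delta>\<^sub>n\<close> is monic (\<open>F_tr_eq\<close>). For
  proper \<open>M\<close>, the cotruncation vanishes exactly when \<open>M\<close> vanishes below \<open>n - 1\<close> and \<open>\<delta>\<^sub>n\<close> has zero
  cokernel; a proper arrow with zero cokernel is epic (\<open>Ker_cot_proper_iff\<close>).
\<close>

section \<open>Zero arrows, kernels and cokernels in pointed categories\<close>

lemma homI: "f \<in> Arr C \<Longrightarrow> f \<in> hom C (Dom C f) (Cod C f)"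
  by (simp add: hom_def)

lemma hom_Arr: "f \<in> hom C A B \<Longrightarrow> f \<in> Arr C"
  and hom_Dom: "f \<in> hom C A B \<Longrightarrow> Dom C f = A"
  and hom_Cod: "f \<in> hom C A B \<Longrightarrow> Cod C f = B"
  by (simp_all add: hom_def)

lemmas homD = hom_Arr hom_Dom hom_Cod

context category
begin

lemma hom_Obj: "f \<in> hom C A B \<Longrightarrow> A \<in> Obj C \<and> B \<in> Obj C"
  using Dom_Obj Cod_Obj by (auto simp: hom_def)

lemma monicI:
  assumes "m \<in> hom C A B"
    and "\<And>D u v. \<lbrakk>u \<in> hom C D A; v \<in> hom C D A; m \<cdot> u = m \<cdot> v\<rbrakk> \<Longrightarrow> u = v"
  shows "monic C m"
  using assms unfolding monic_def hom_def by blast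

lemma monicD:
  assumes "monic C m" "m \<in> hom C A B" "u \<in> hom C D A" "v \<in> hom C D A" "m \<cdot> u = m \<cdot> v"
  shows "u = v"
  using assms(1,3-) homD[OF assms(2)] unfolding monic_def by auto

lemma epicI:
  assumes "e \<in> hom C A B"
    and "\<And>D u v. \<lbrakk>u \<in> hom C B D; v \<in> hom C B D; u \<cdot> e = v \<cdot> e\<rbrakk> \<Longrightarrow> u = v"
  shows "epic C e"
  using assms unfolding epic_def hom_def by blast

lemma epicD:
  assumes "epic C e" "e \<in> hom C A B" "u \<in> hom C B D" "v \<in> hom C B D" "u \<cdot> e = v \<cdot> e"
  shows "u = v"
  using assms(1,3-) homD[OF assms(2)] unfolding epic_def by auto

lemma isoE:
  assumes "iso C f" "f \<in> hom C A B"
  obtains g where "g \<in> hom C B A" "g \<cdot> f = Idn C A" "f \<cdot> g = Idn C B"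
  using assms(1) homD[OF assms(2)] that unfolding iso_def by auto

lemma monic_comp_cancel:
  assumes "monic C (m \<cdot> u)" "u \<in> hom C A B" "m \<in> hom C B D"
  shows "monic C u"
proof (rule monicI[OF assms(2)])
  fix E x y assume *: "x \<in> hom C E A" "y \<in> hom C E A" "u \<cdot> x = u \<cdot> y"
  then have "(m \<cdot> u) \<cdot> x = (m \<cdot> u) \<cdot> y"
    using Comp_assoc[OF _ assms(2,3)] by simp
  then show "x = y" using monicD[OF assms(1)] Comp_hom assms * by blast
qed

lemma monic_comp:
  assumes "monic C m" "monic C u" "u \<in> hom C A B" "m \<in> hom C B D"
  shows "monic C (m \<cdot> u)"
proof (rule monicI)
  show "m \<cdot> u \<in> hom C A D" using assms Comp_hom by blast
  fix E x y assume *: "x \<in> hom C E A" "y \<in> hom C E A" "(m \<cdot> u) \<cdot> x = (m \<cdot> u) \<cdot> y"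
  then have "m \<cdot> (u \<cdot> x) = m \<cdot> (u \<cdot> y)"
    using Comp_assoc[OF _ assms(3,4)] by simp
  then have "u \<cdot> x = u \<cdot> y" using monicD[OF assms(1,4)] Comp_hom assms * by blast
  then show "x = y" using monicD[OF assms(2,3)] * by blast
qed

lemma epic_comp:
  assumes "epic C e" "epic C d" "d \<in> hom C A B" "e \<in> hom C B D"
  shows "epic C (e \<cdot> d)"
proof (rule epicI)
  show "e \<cdot> d \<in> hom C A D" using assms Comp_hom by blast
  fix E x y assume *: "x \<in> hom C D E" "y \<in> hom C D E" "x \<cdot> (e \<cdot> d) = y \<cdot> (e \<cdot> d)"
  then have "(x \<cdot> e) \<cdot> d = (y \<cdot> e) \<cdot> d"
    using Comp_assoc[OF assms(3,4)] by simp
  then have "x \<cdot> e = y \<cdot> e" using epicD[OF assms(2,3)] Comp_hom assms * by blast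
  then show "x = y" using epicD[OF assms(1,4)] * by blast
qed

lemma section_monic:
  assumes "f \<in> hom C A B" "g \<in> hom C B A" "g \<cdot> f = Idn C A"
  shows "monic C f"
proof (rule monicI[OF assms(1)])
  fix D u v assume *: "u \<in> hom C D A" "v \<in> hom C D A" "f \<cdot> u = f \<cdot> v"
  have "(g \<cdot> f) \<cdot> u = (g \<cdot> f) \<cdot> v"
    using Comp_assoc[OF *(1) assms(1,2)] Comp_assoc[OF *(2) assms(1,2)] *(3) by simp
  then show "u = v" using Idn_Comp * assms(3) by simp
qed

lemma retraction_epic:
  assumes "f \<in> hom C A B" "g \<in> hom C B A" "f \<cdot> g = Idn C B"
  shows "epic C f"
proof (rule epicI[OF assms(1)])
  fix D u v assume *: "u \<in> hom C B D" "v \<in> hom C B D" "u \<cdot> f = v \<cdot> f"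
  have "u \<cdot> (f \<cdot> g) = v \<cdot> (f \<cdot> g)"
    using Comp_assoc[OF assms(2,1) *(1)] Comp_assoc[OF assms(2,1) *(2)] *(3) by simp
  then show "u = v" using Comp_Idn * assms(3) by simp
qed

end

context pointed_category
begin

lemma Zero_zero: "zero_obj C (Zero C)"
  unfolding Zero_def using ex_zero by (rule someI_ex)

lemma zero_obj_Obj: "zero_obj C Z \<Longrightarrow> Z \<in> Obj C"
  by (simp add: zero_obj_def)

lemma zero_obj_hom_eq:
  assumes "zero_obj C Z"
  shows "\<lbrakk>f \<in> hom C A Z; g \<in> hom C A Z\<rbrakk> \<Longrightarrow> f = g"
    and "\<lbrakk>f \<in> hom C Z A; g \<in> hom C Z A\<rbrakk> \<Longrightarrow> f = g"
  using assms hom_Obj[of f] unfolding zero_obj_def by blast+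

lemma zero_arr_unique:
  assumes "f \<in> hom C A B" "g \<in> hom C A B" "zero_arr C f" "zero_arr C g"
  shows "f = g"
proof -
  obtain Z a b where Z: "zero_obj C Z" "a \<in> hom C A Z" "b \<in> hom C Z B" "f = b \<cdot> a"
    using assms(3) homD[OF assms(1)] unfolding zero_arr_def by auto
  obtain W c d where W: "zero_obj C W" "c \<in> hom C A W" "d \<in> hom C W B" "g = d \<cdot> c"
    using assms(4) homD[OF assms(2)] unfolding zero_arr_def by auto
  obtain t where t: "t \<in> hom C Z W" using Z W zero_obj_def by metis
  have "c = t \<cdot> a" using zero_obj_hom_eq(1)[OF W(1)] W Z t Comp_hom by blast
  moreover have "d \<cdot> t = b" using zero_obj_hom_eq(2)[OF Z(1)] W Z t Comp_hom by blast
  ultimately show ?thesis using Z(4) W(4) Comp_assoc[OF Z(2) t W(3)] by simp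
qed

lemma zero_map_props:
  assumes "A \<in> Obj C" "B \<in> Obj C"
  shows "zero_map C A B \<in> hom C A B \<and> zero_arr C (zero_map C A B)"
proof -
  obtain a b where ab: "a \<in> hom C A (Zero C)" "b \<in> hom C (Zero C) B"
    using assms Zero_zero zero_obj_def by metis
  have h: "b \<cdot> a \<in> hom C A B" using ab Comp_hom by blast
  have "zero_arr C (b \<cdot> a)" unfolding zero_arr_def
    using homD[OF h] ab Zero_zero by auto
  then have "\<exists>!f. f \<in> hom C A B \<and> zero_arr C f"
    using zero_arr_unique[of _ A B] h by blast
  then show ?thesis unfolding zero_map_def by (rule theI')
qed

lemmas zero_map_hom = zero_map_props[THEN conjunct1]

lemma zero_arr_iff: "f \<in> hom C A B \<Longrightarrow> zero_arr C f \<longleftrightarrow> f = zero_map C A B"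
  using zero_arr_unique[of f A B "zero_map C A B"] zero_map_props[of A B] hom_Obj[of f A B] by blast

lemma hom_zero_obj:
  "\<lbrakk>f \<in> hom C A B; zero_obj C A \<or> zero_obj C B\<rbrakk> \<Longrightarrow> f = zero_map C A B"
  using zero_obj_hom_eq[of _ f] zero_map_hom[of A B] hom_Obj[of f A B] by blast

lemma comp_zero:
  assumes "A \<in> Obj C" "f \<in> hom C B D"
  shows "f \<cdot> zero_map C A B = zero_map C A D"
proof -
  have B: "B \<in> Obj C" using assms hom_Obj by blast
  obtain Z a b where Z: "zero_obj C Z" "a \<in> hom C A Z" "b \<in> hom C Z B" "zero_map C A B = b \<cdot> a"
    using zero_map_props[OF assms(1) B] homD[of "zero_map C A B" C A B]
    unfolding zero_arr_def by auto
  have h: "f \<cdot> zero_map C A B \<in> hom C A D" using assms B zero_map_hom Comp_hom by blast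
  have "f \<cdot> zero_map C A B = (f \<cdot> b) \<cdot> a" using Z(4) Comp_assoc[OF Z(2,3) assms(2)] by simp
  moreover have "f \<cdot> b \<in> hom C Z D" using Z assms Comp_hom by blast
  ultimately have "zero_arr C (f \<cdot> zero_map C A B)"
    unfolding zero_arr_def using homD[OF h] Z(1,2) by auto
  then show ?thesis using zero_arr_iff h by blast
qed

lemma zero_comp:
  assumes "D \<in> Obj C" "f \<in> hom C A B"
  shows "zero_map C B D \<cdot> f = zero_map C A D"
proof -
  have B: "B \<in> Obj C" using assms hom_Obj by blast
  obtain Z a b where Z: "zero_obj C Z" "a \<in> hom C B Z" "b \<in> hom C Z D" "zero_map C B D = b \<cdot> a"
    using zero_map_props[OF B assms(1)] homD[of "zero_map C B D" C B D]
    unfolding zero_arr_def by auto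
  have h: "zero_map C B D \<cdot> f \<in> hom C A D" using assms B zero_map_hom Comp_hom by blast
  have "zero_map C B D \<cdot> f = b \<cdot> (a \<cdot> f)" using Z(4) Comp_assoc[OF assms(2) Z(2,3)] by simp
  moreover have "a \<cdot> f \<in> hom C A Z" using Z assms Comp_hom by blast
  ultimately have "zero_arr C (zero_map C B D \<cdot> f)"
    unfolding zero_arr_def using homD[OF h] Z(1,3) by auto
  then show ?thesis using zero_arr_iff h by blast
qed

lemma zero_obj_iff_Idn:
  assumes "A \<in> Obj C"
  shows "zero_obj C A \<longleftrightarrow> Idn C A = zero_map C A A"
proof
  assume "zero_obj C A"
  then show "Idn C A = zero_map C A A" using hom_zero_obj Idn_hom assms by blast
next
  assume *: "Idn C A = zero_map C A A"
  have "f = zero_map C B A" if "f \<in> hom C B A" for f B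
    using Idn_Comp[OF that] zero_comp[OF assms that] * by simp
  moreover have "f = zero_map C A B" if "f \<in> hom C A B" for f B
    using Comp_Idn[OF that] comp_zero[OF assms that] * by simp
  ultimately show "zero_obj C A" unfolding zero_obj_def using assms zero_map_hom by blast
qed

lemma zero_obj_monic:
  assumes "monic C f" "f \<in> hom C A Z" "zero_obj C Z"
  shows "zero_obj C A"
proof -
  have A: "A \<in> Obj C" using assms hom_Obj by blast
  have "Idn C A = zero_map C A A"
    using monicD[OF assms(1,2) Idn_hom[OF A] zero_map_hom[OF A A]]
      zero_obj_hom_eq(1)[OF assms(3)] Comp_hom assms(2) Idn_hom[OF A] zero_map_hom[OF A A] by blast
  then show ?thesis using zero_obj_iff_Idn A by blast
qed

lemma zero_obj_iso:
  assumes "iso C f" "f \<in> hom C A B" "zero_obj C A"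
  shows "zero_obj C B"
proof -
  obtain g where "g \<in> hom C B A" "g \<cdot> f = Idn C A" "f \<cdot> g = Idn C B"
    using isoE assms by blast
  then have "monic C g" using section_monic assms(2) by blast
  then show ?thesis using zero_obj_monic \<open>g \<in> hom C B A\<close> assms(3) by blast
qed

lemma zero_cancel_monic:
  assumes "monic C m" "m \<in> hom C A B" "f \<in> hom C D A" "m \<cdot> f = zero_map C D B"
  shows "f = zero_map C D A"
proof -
  have "D \<in> Obj C" "A \<in> Obj C" using assms hom_Obj by blast+
  then show ?thesis
    using monicD[OF assms(1,2,3) zero_map_hom] comp_zero assms by simp
qed

lemma zero_cancel_epic:
  assumes "epic C e" "e \<in> hom C A B" "f \<in> hom C B D" "f \<cdot> e = zero_map C A D"
  shows "f = zero_map C B D"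
proof -
  have "D \<in> Obj C" "B \<in> Obj C" using assms hom_Obj by blast+
  then show ?thesis
    using epicD[OF assms(1,2,3) zero_map_hom] zero_comp assms by simp
qed

lemma is_kernelI:
  assumes "f \<in> hom C A B" "k \<in> hom C K A" "f \<cdot> k = zero_map C K B" "monic C k"
    and "\<And>D h. \<lbrakk>h \<in> hom C D A; f \<cdot> h = zero_map C D B\<rbrakk> \<Longrightarrow> \<exists>u \<in> hom C D K. k \<cdot> u = h"
  shows "is_kernel C f k"
proof -
  have "f \<cdot> k \<in> hom C K B" using assms Comp_hom by blast
  then have 1: "zero_arr C (f \<cdot> k)" using assms zero_arr_iff by blast
  have "\<exists>!u. u \<in> hom C D K \<and> k \<cdot> u = h" if "h \<in> hom C D A" "zero_arr C (f \<cdot> h)" for D h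
  proof -
    have "f \<cdot> h = zero_map C D B" using that assms Comp_hom zero_arr_iff by blast
    then show ?thesis using assms(5)[OF that(1)] monicD[OF assms(4,2)] by blast
  qed
  then show ?thesis using 1 assms(2) homD[OF assms(1)] homD[OF assms(2)]
    unfolding is_kernel_def by simp
qed

lemma is_kernelD:
  assumes "is_kernel C f k" "f \<in> hom C A B"
  shows "k \<in> hom C (Dom C k) A" "f \<cdot> k = zero_map C (Dom C k) B" "monic C k"
    "\<lbrakk>h \<in> hom C D A; f \<cdot> h = zero_map C D B\<rbrakk> \<Longrightarrow> \<exists>u \<in> hom C D (Dom C k). k \<cdot> u = h"
proof -
  show k: "k \<in> hom C (Dom C k) A" using assms(1) homD[OF assms(2)] unfolding is_kernel_def by simp
  show z: "f \<cdot> k = zero_map C (Dom C k) B"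
    using assms k Comp_hom zero_arr_iff unfolding is_kernel_def by blast
  have U: "\<exists>!u. u \<in> hom C D (Dom C k) \<and> k \<cdot> u = h"
    if "h \<in> hom C D A" "f \<cdot> h = zero_map C D B" for h D
  proof -
    have "zero_arr C (f \<cdot> h)" using that assms(2) Comp_hom zero_arr_iff by metis
    then show ?thesis using assms(1) homD[OF assms(2)] that unfolding is_kernel_def by simp
  qed
  show "\<exists>u \<in> hom C D (Dom C k). k \<cdot> u = h" if "h \<in> hom C D A" "f \<cdot> h = zero_map C D B"
    using U[OF that] by blast
  show "monic C k"
  proof (rule monicI[OF k])
    fix D u v assume *: "u \<in> hom C D (Dom C k)" "v \<in> hom C D (Dom C k)" "k \<cdot> u = k \<cdot> v"
    have "f \<cdot> (k \<cdot> u) = zero_map C D B"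
      using Comp_assoc[OF *(1) k assms(2)] z zero_comp[OF _ *(1)] hom_Obj[OF assms(2)] by simp
    then show "u = v" using U[OF Comp_hom[OF *(1) k]] *(1,2) *(3)[symmetric] by blast
  qed
qed

lemma is_cokernelI:
  assumes "f \<in> hom C A B" "q \<in> hom C B Q" "q \<cdot> f = zero_map C A Q" "epic C q"
    and "\<And>D h. \<lbrakk>h \<in> hom C B D; h \<cdot> f = zero_map C A D\<rbrakk> \<Longrightarrow> \<exists>u \<in> hom C Q D. u \<cdot> q = h"
  shows "is_cokernel C f q"
proof -
  have "q \<cdot> f \<in> hom C A Q" using assms Comp_hom by blast
  then have 1: "zero_arr C (q \<cdot> f)" using assms zero_arr_iff by blast
  have "\<exists>!u. u \<in> hom C Q D \<and> u \<cdot> q = h" if "h \<in> hom C B D" "zero_arr C (h \<cdot> f)" for D h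
  proof -
    have "h \<cdot> f = zero_map C A D" using that assms Comp_hom zero_arr_iff by blast
    then show ?thesis using assms(5)[OF that(1)] epicD[OF assms(4,2)] by blast
  qed
  then show ?thesis using 1 assms(2) homD[OF assms(1)] homD[OF assms(2)]
    unfolding is_cokernel_def by simp
qed

lemma is_cokernelD:
  assumes "is_cokernel C f q" "f \<in> hom C A B"
  shows "q \<in> hom C B (Cod C q)" "q \<cdot> f = zero_map C A (Cod C q)" "epic C q"
    "\<lbrakk>h \<in> hom C B D; h \<cdot> f = zero_map C A D\<rbrakk> \<Longrightarrow> \<exists>u \<in> hom C (Cod C q) D. u \<cdot> q = h"
proof -
  show q: "q \<in> hom C B (Cod C q)" using assms(1) homD[OF assms(2)] unfolding is_cokernel_def by simp
  show z: "q \<cdot> f = zero_map C A (Cod C q)"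
    using assms q Comp_hom zero_arr_iff unfolding is_cokernel_def by blast
  have U: "\<exists>!u. u \<in> hom C (Cod C q) D \<and> u \<cdot> q = h"
    if "h \<in> hom C B D" "h \<cdot> f = zero_map C A D" for h D
  proof -
    have "zero_arr C (h \<cdot> f)" using that assms(2) Comp_hom zero_arr_iff by metis
    then show ?thesis using assms(1) homD[OF assms(2)] that unfolding is_cokernel_def by simp
  qed
  show "\<exists>u \<in> hom C (Cod C q) D. u \<cdot> q = h" if "h \<in> hom C B D" "h \<cdot> f = zero_map C A D"
    using U[OF that] by blast
  show "epic C q"
  proof (rule epicI[OF q])
    fix D u v assume *: "u \<in> hom C (Cod C q) D" "v \<in> hom C (Cod C q) D" "u \<cdot> q = v \<cdot> q"
    have "(u \<cdot> q) \<cdot> f = zero_map C A D"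
      using Comp_assoc[OF assms(2) q *(1)] z comp_zero[OF _ *(1)] hom_Obj[OF assms(2)] by simp
    then show "u = v" using U[OF Comp_hom[OF q *(1)]] *(1,2) *(3)[symmetric] by blast
  qed
qed

lemma Idn_monic: "A \<in> Obj C \<Longrightarrow> monic C (Idn C A)"
  using section_monic Idn_hom Idn_Comp by metis

lemma Idn_epic: "A \<in> Obj C \<Longrightarrow> epic C (Idn C A)"
  using retraction_epic Idn_hom Idn_Comp by metis

lemma zero_map_from_zero_monic:
  assumes "A \<in> Obj C" "zero_obj C Z"
  shows "monic C (zero_map C Z A)"
  using monicI[OF zero_map_hom[OF zero_obj_Obj[OF assms(2)] assms(1)]] zero_obj_hom_eq assms by blast

lemma zero_map_to_zero_epic:
  assumes "A \<in> Obj C" "zero_obj C Z"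
  shows "epic C (zero_map C A Z)"
  using epicI[OF zero_map_hom[OF assms(1) zero_obj_Obj[OF assms(2)]]] zero_obj_hom_eq assms by blast

lemma short_exact_zero_Idn:
  assumes A: "A \<in> Obj C" and Z: "zero_obj C Z"
  shows "short_exact C (zero_map C Z A) (Idn C A)"
proof -
  have ZO: "Z \<in> Obj C" using Z zero_obj_Obj by blast
  note h = zero_map_hom[OF ZO A] zero_map_hom[OF A ZO] Idn_hom[OF A]
  have "is_kernel C (Idn C A) (zero_map C Z A)"
  proof (rule is_kernelI[OF h(3,1)])
    show "Idn C A \<cdot> zero_map C Z A = zero_map C Z A" using Idn_Comp h by blast
    show "monic C (zero_map C Z A)" using zero_map_from_zero_monic assms by blast
    fix D x assume *: "x \<in> hom C D A" "Idn C A \<cdot> x = zero_map C D A"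
    then have "x = zero_map C D A" using Idn_Comp by metis
    moreover have "D \<in> Obj C" using * hom_Obj by blast
    ultimately show "\<exists>u \<in> hom C D Z. zero_map C Z A \<cdot> u = x"
      using zero_map_hom[OF _ ZO] zero_comp[OF A] by metis
  qed
  moreover have "is_cokernel C (zero_map C Z A) (Idn C A)"
  proof (rule is_cokernelI[OF h(1,3)])
    show "Idn C A \<cdot> zero_map C Z A = zero_map C Z A" using Idn_Comp h by blast
    show "epic C (Idn C A)" using Idn_epic A by blast
  next
    fix D x assume "x \<in> hom C A D"
    then show "\<exists>u \<in> hom C A D. u \<cdot> Idn C A = x" using Comp_Idn by blast
  qed
  ultimately show ?thesis by (simp add: short_exact_def)
qed

lemma short_exact_Idn_zero:
  assumes A: "A \<in> Obj C" and Z: "zero_obj C Z"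
  shows "short_exact C (Idn C A) (zero_map C A Z)"
proof -
  have ZO: "Z \<in> Obj C" using Z zero_obj_Obj by blast
  note h = zero_map_hom[OF ZO A] zero_map_hom[OF A ZO] Idn_hom[OF A]
  have "is_kernel C (zero_map C A Z) (Idn C A)"
  proof (rule is_kernelI[OF h(2,3)])
    show "zero_map C A Z \<cdot> Idn C A = zero_map C A Z" using Comp_Idn h by blast
    show "monic C (Idn C A)" using Idn_monic A by blast
  next
    fix D x assume "x \<in> hom C D A"
    then show "\<exists>u \<in> hom C D A. Idn C A \<cdot> u = x" using Idn_Comp by blast
  qed
  moreover have "is_cokernel C (Idn C A) (zero_map C A Z)"
  proof (rule is_cokernelI[OF h(3,2)])
    show "zero_map C A Z \<cdot> Idn C A = zero_map C A Z" using Comp_Idn h by blast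
    show "epic C (zero_map C A Z)" using zero_map_to_zero_epic assms by blast
    fix D x assume *: "x \<in> hom C A D" "x \<cdot> Idn C A = zero_map C A D"
    then have "x = zero_map C A D" using Comp_Idn by metis
    moreover have "D \<in> Obj C" using * hom_Obj by blast
    ultimately show "\<exists>u \<in> hom C Z D. u \<cdot> zero_map C A Z = x"
      using zero_map_hom[OF ZO] comp_zero[OF A] by metis
  qed
  ultimately show ?thesis by (simp add: short_exact_def)
qed

text \<open>An arrow killing the kernel of \<open>e\<close> also kills the arrow of which \<open>e\<close> is the cokernel, because the
  latter factors through the kernel.\<close>

lemma normal_epi_cokernel_of_kernel:
  assumes "normal_epi C e" "is_kernel C e k"
  shows "is_cokernel C k e"
proof -
  obtain f where f: "is_cokernel C f e" using assms normal_epi_def by metis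
  define A B I where "A = Dom C f" and "B = Cod C f" and "I = Cod C e"
  have fh: "f \<in> hom C A B" using f unfolding is_cokernel_def A_def B_def by (simp add: homI)
  note ce = is_cokernelD[OF f fh, folded I_def]
  note ke = is_kernelD[OF assms(2) ce(1)]
  obtain t where t: "t \<in> hom C A (Dom C k)" "k \<cdot> t = f"
    using ke(4)[OF fh ce(2)] by blast
  show ?thesis
  proof (rule is_cokernelI[OF ke(1) ce(1) ke(2) ce(3)])
    fix D h assume h: "h \<in> hom C B D" "h \<cdot> k = zero_map C (Dom C k) D"
    then have "h \<cdot> f = zero_map C A D"
      using t Comp_assoc[OF t(1) ke(1) h(1)] zero_comp[OF _ t(1)] hom_Obj[OF h(1)] by simp
    then show "\<exists>u \<in> hom C I D. u \<cdot> e = h" using ce(4) h(1) by blast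
  qed
qed

end

section \<open>Pullbacks\<close>

context category
begin

lemma pullbackI:
  assumes f: "f \<in> hom C A D" and g: "g \<in> hom C B D" and p: "p \<in> hom C P A" and q: "q \<in> hom C P B"
    and "f \<cdot> p = g \<cdot> q"
    and J: "\<And>E u v. \<lbrakk>u \<in> hom C E P; v \<in> hom C E P; p \<cdot> u = p \<cdot> v; q \<cdot> u = q \<cdot> v\<rbrakk> \<Longrightarrow> u = v"
    and L: "\<And>E a b. \<lbrakk>a \<in> hom C E A; b \<in> hom C E B; f \<cdot> a = g \<cdot> b\<rbrakk>
      \<Longrightarrow> \<exists>u \<in> hom C E P. p \<cdot> u = a \<and> q \<cdot> u = b"
  shows "pullback C f g p q"
proof -
  have "\<exists>!u. u \<in> hom C E P \<and> p \<cdot> u = a \<and> q \<cdot> u = b"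
    if ab: "a \<in> hom C E A" "b \<in> hom C E B" "f \<cdot> a = g \<cdot> b" for E a b
  proof -
    obtain u where u: "u \<in> hom C E P" "p \<cdot> u = a" "q \<cdot> u = b" using L[OF ab] by blast
    then have "v = u" if "v \<in> hom C E P \<and> p \<cdot> v = a \<and> q \<cdot> v = b" for v
      using J[of v E u] that by simp
    then show ?thesis using u by blast
  qed
  then show ?thesis
    unfolding pullback_def using assms(5) homD[OF f] homD[OF g] homD[OF p] p q by simp
qed

lemma pullbackD:
  assumes "pullback C f g p q" "f \<in> hom C A D" "g \<in> hom C B D"
  shows "p \<in> hom C (Dom C p) A" "q \<in> hom C (Dom C p) B" "f \<cdot> p = g \<cdot> q"
    and "\<lbrakk>u \<in> hom C E (Dom C p); v \<in> hom C E (Dom C p); p \<cdot> u = p \<cdot> v; q \<cdot> u = q \<cdot> v\<rbrakk> \<Longrightarrow> u = v"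
    and "\<lbrakk>a \<in> hom C E A; b \<in> hom C E B; f \<cdot> a = g \<cdot> b\<rbrakk>
      \<Longrightarrow> \<exists>u \<in> hom C E (Dom C p). p \<cdot> u = a \<and> q \<cdot> u = b"
proof -
  show p: "p \<in> hom C (Dom C p) A" and q: "q \<in> hom C (Dom C p) B" and e: "f \<cdot> p = g \<cdot> q"
    using assms(1) homD[OF assms(2)] homD[OF assms(3)] unfolding pullback_def by auto
  have U: "\<exists>!u. u \<in> hom C E (Dom C p) \<and> p \<cdot> u = a \<and> q \<cdot> u = b"
    if "a \<in> hom C E A" "b \<in> hom C E B" "f \<cdot> a = g \<cdot> b" for E a b
    using assms(1) that homD[OF assms(2)] homD[OF assms(3)] unfolding pullback_def by simp
  show "\<exists>u \<in> hom C E (Dom C p). p \<cdot> u = a \<and> q \<cdot> u = b"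
    if "a \<in> hom C E A" "b \<in> hom C E B" "f \<cdot> a = g \<cdot> b" using U[OF that] by blast
  show "u = v"
    if "u \<in> hom C E (Dom C p)" "v \<in> hom C E (Dom C p)" "p \<cdot> u = p \<cdot> v" "q \<cdot> u = q \<cdot> v"
  proof -
    have "f \<cdot> (p \<cdot> u) = g \<cdot> (q \<cdot> u)"
      using Comp_assoc[OF that(1) p assms(2)] Comp_assoc[OF that(1) q assms(3)] e by simp
    then show ?thesis
      using U[OF Comp_hom[OF that(1) p] Comp_hom[OF that(1) q]] that by metis
  qed
qed

lemma coequalizerD:
  assumes "coequalizer C f g q" "f \<in> hom C A B"
  shows "q \<in> hom C B (Cod C q)" "q \<cdot> f = q \<cdot> g"
    and "\<lbrakk>h \<in> hom C B D; h \<cdot> f = h \<cdot> g\<rbrakk> \<Longrightarrow> \<exists>u \<in> hom C (Cod C q) D. u \<cdot> q = h"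
proof -
  show "q \<in> hom C B (Cod C q)" "q \<cdot> f = q \<cdot> g"
    using assms(1) homD[OF assms(2)] unfolding coequalizer_def by auto
  show "\<exists>u \<in> hom C (Cod C q) D. u \<cdot> q = h" if "h \<in> hom C B D" "h \<cdot> f = h \<cdot> g"
  proof -
    have "\<exists>!u. u \<in> hom C (Cod C q) D \<and> u \<cdot> q = h"
      using assms(1) homD[OF assms(2)] that unfolding coequalizer_def by simp
    then show ?thesis by blast
  qed
qed

lemma regular_epi_epic:
  assumes "regular_epi C e"
  shows "epic C e"
proof -
  obtain f g where c: "coequalizer C f g e" using assms regular_epi_def by metis
  then have f: "f \<in> hom C (Dom C f) (Cod C f)" and g: "g \<in> hom C (Dom C f) (Cod C f)"
    and e: "e \<in> hom C (Cod C f) (Cod C e)" and fg: "e \<cdot> f = e \<cdot> g"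
    unfolding coequalizer_def by (simp_all add: homI)
  show ?thesis
  proof (rule epicI[OF e])
    fix D u v assume *: "u \<in> hom C (Cod C e) D" "v \<in> hom C (Cod C e) D" "u \<cdot> e = v \<cdot> e"
    have "(u \<cdot> e) \<cdot> f = (u \<cdot> e) \<cdot> g"
      using Comp_assoc[OF f e *(1)] Comp_assoc[OF g e *(1)] fg by simp
    moreover have "u \<cdot> e \<in> hom C (Cod C f) D" using Comp_hom e * by blast
    ultimately have "\<exists>!t. t \<in> hom C (Cod C e) D \<and> t \<cdot> e = u \<cdot> e"
      using c unfolding coequalizer_def by blast
    then show "u = v" using * by metis
  qed
qed

end

context pointed_category
begin

text \<open>Change of base along \<open>0 \<rightarrow> B\<close> is the formation of kernels; it turns protomodularity into a statement
  about kernels of split epimorphisms.\<close>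

lemma kernel_pullback:
  assumes k: "is_kernel C p x" and p: "p \<in> hom C A B" and Z: "zero_obj C Z"
  shows "pullback C p (zero_map C Z B) x (zero_map C (Dom C x) Z)"
proof -
  note K = is_kernelD[OF k p]
  have B: "B \<in> Obj C" and DX: "Dom C x \<in> Obj C" using p K(1) hom_Obj by blast+
  note ZO = zero_obj_Obj[OF Z]
  show ?thesis
  proof (rule pullbackI[OF p zero_map_hom[OF ZO B] K(1) zero_map_hom[OF DX ZO]])
    show "p \<cdot> x = zero_map C Z B \<cdot> zero_map C (Dom C x) Z"
      using K(2) zero_comp[OF B zero_map_hom[OF DX ZO]] by simp
    show "u = v" if "u \<in> hom C E (Dom C x)" "v \<in> hom C E (Dom C x)" "x \<cdot> u = x \<cdot> v" for E u v
      using monicD[OF K(3,1) that] .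
    fix E a b assume *: "a \<in> hom C E A" "b \<in> hom C E Z" "p \<cdot> a = zero_map C Z B \<cdot> b"
    then have "p \<cdot> a = zero_map C E B" using zero_comp[OF B *(2)] by simp
    then obtain u where u: "u \<in> hom C E (Dom C x)" "x \<cdot> u = a" using K(4) * by blast
    then have "zero_map C (Dom C x) Z \<cdot> u = b"
      using zero_obj_hom_eq(1)[OF Z _ *(2)] Comp_hom zero_map_hom[OF DX ZO] by blast
    then show "\<exists>u \<in> hom C E (Dom C x). x \<cdot> u = a \<and> zero_map C (Dom C x) Z \<cdot> u = b" using u by blast
  qed
qed

text \<open>The pairs \<open>(0, y)\<close> in the kernel pair of \<open>f\<close> are those with \<open>y\<close> in the kernel of \<open>f\<close>.\<close>

lemma kernel_pair_kernel:
  assumes f: "f \<in> hom C A B" and pb: "pullback C f f p q" and k: "is_kernel C f k"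
    and u: "u \<in> hom C (Dom C k) (Dom C p)" "p \<cdot> u = zero_map C (Dom C k) A" "q \<cdot> u = k"
  shows "is_kernel C p u"
proof -
  note P = pullbackD[OF pb f f] and K = is_kernelD[OF k f]
  have O: "A \<in> Obj C" "B \<in> Obj C" using f hom_Obj by blast+
  show ?thesis
  proof (rule is_kernelI[OF P(1) u(1,2)])
    show "monic C u" using monic_comp_cancel[OF _ u(1) P(2)] u(3) K(3) by simp
    fix D h assume h: "h \<in> hom C D (Dom C p)" "p \<cdot> h = zero_map C D A"
    have "f \<cdot> (q \<cdot> h) = f \<cdot> (p \<cdot> h)"
      using Comp_assoc[OF h(1) P(1) f] Comp_assoc[OF h(1) P(2) f] P(3) by simp
    then have "f \<cdot> (q \<cdot> h) = zero_map C D B"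
      using h comp_zero[OF _ f] hom_Obj[OF h(1)] by simp
    then obtain t where t: "t \<in> hom C D (Dom C k)" "k \<cdot> t = q \<cdot> h"
      using K(4)[OF Comp_hom[OF h(1) P(2)]] by blast
    have "p \<cdot> (u \<cdot> t) = p \<cdot> h"
      using Comp_assoc[OF t(1) u(1) P(1)] u(2) zero_comp[OF O(1) t(1)] h(2) by simp
    moreover have "q \<cdot> (u \<cdot> t) = q \<cdot> h"
      using Comp_assoc[OF t(1) u(1) P(2)] u(3) t(2) by simp
    ultimately have "u \<cdot> t = h" using P(4)[OF Comp_hom[OF t(1) u(1)] h(1)] by blast
    then show "\<exists>t \<in> hom C D (Dom C k). u \<cdot> t = h" using t by blast
  qed
qed

end

section \<open>Kernels and factorizations in semi-abelian categories\<close>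

context barr_exact_pointed
begin

lemma ex_kernel:
  assumes "f \<in> hom C A B"
  shows "\<exists>k. is_kernel C f k"
proof -
  note O = hom_Obj[OF assms] and Z = Zero_zero
  note z = zero_map_hom[OF zero_obj_Obj[OF Z] conjunct2[OF O]]
  obtain k q where pb: "pullback C f (zero_map C (Zero C) B) k q"
    using ex_pullback homD[OF assms] homD[OF z] by metis
  note P = pullbackD[OF pb assms z]
  have "is_kernel C f k"
  proof (rule is_kernelI[OF assms P(1)])
    show "f \<cdot> k = zero_map C (Dom C k) B" using P(3) zero_comp[OF _ P(2)] O by simp
    show "monic C k"
    proof (rule monicI[OF P(1)])
      fix D u v assume *: "u \<in> hom C D (Dom C k)" "v \<in> hom C D (Dom C k)" "k \<cdot> u = k \<cdot> v"
      then have "q \<cdot> u = q \<cdot> v" using zero_obj_hom_eq(1)[OF Z] Comp_hom P(2) by blast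
      then show "u = v" using P(4) * by blast
    qed
    fix D h assume h: "h \<in> hom C D A" "f \<cdot> h = zero_map C D B"
    have t: "zero_map C D (Zero C) \<in> hom C D (Zero C)"
      using zero_map_hom hom_Obj[OF h(1)] zero_obj_Obj[OF Z] by blast
    have "f \<cdot> h = zero_map C (Zero C) B \<cdot> zero_map C D (Zero C)"
      using h zero_comp[OF _ t] O by simp
    then show "\<exists>u \<in> hom C D (Dom C k). k \<cdot> u = h" using P(5)[OF h(1) t] by blast
  qed
  then show ?thesis by blast
qed

lemma ker_kernel: "f \<in> hom C A B \<Longrightarrow> is_kernel C f (ker C f)"
  unfolding ker_def using ex_kernel by (rule someI_ex)

text \<open>A product is a pullback over a zero object.\<close>

lemma ex_product:
  assumes "A \<in> Obj C" "B \<in> Obj C"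
  shows "\<exists>P p q. p \<in> hom C P A \<and> q \<in> hom C P B \<and>
    (\<forall>E. \<forall>a \<in> hom C E A. \<forall>b \<in> hom C E B. \<exists>u \<in> hom C E P. p \<cdot> u = a \<and> q \<cdot> u = b) \<and>
    (\<forall>E. \<forall>u \<in> hom C E P. \<forall>v \<in> hom C E P. p \<cdot> u = p \<cdot> v \<and> q \<cdot> u = q \<cdot> v \<longrightarrow> u = v)"
proof -
  note Z = Zero_zero
  note a = zero_map_hom[OF assms(1) zero_obj_Obj[OF Z]] and b = zero_map_hom[OF assms(2) zero_obj_Obj[OF Z]]
  obtain p q where pb: "pullback C (zero_map C A (Zero C)) (zero_map C B (Zero C)) p q"
    using ex_pullback homD[OF a] homD[OF b] by metis
  note P = pullbackD[OF pb a b]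
  have "\<exists>u \<in> hom C E (Dom C p). p \<cdot> u = x \<and> q \<cdot> u = y" if "x \<in> hom C E A" "y \<in> hom C E B" for E x y
    using P(5)[OF that] zero_obj_hom_eq(1)[OF Z Comp_hom[OF that(1) a] Comp_hom[OF that(2) b]] by blast
  then show ?thesis using P(1,2,4) by blast
qed

text \<open>The arrow \<open>f\<close> factors through the coequalizer \<open>e\<close> of its kernel pair, and the induced arrow \<open>m\<close> is monic by the usual
  argument: if \<open>m \<cdot> x = m \<cdot> y\<close>, then after covering the domain of \<open>x\<close> and \<open>y\<close> by a regular epimorphism both
  lift along \<open>e\<close>; the two lifts are identified by \<open>f\<close>, hence form a point of its kernel pair, hence are
  identified by \<open>e\<close>.\<close>

lemma ex_regular_epi_monic_factorization:
  assumes f: "f \<in> hom C A B"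
  shows "\<exists>e m I p q. e \<in> hom C A I \<and> m \<in> hom C I B \<and> f = m \<cdot> e \<and> monic C m \<and>
    coequalizer C p q e \<and> pullback C f f p q"
proof -
  obtain p q where pb: "pullback C f f p q" using ex_pullback homD[OF f] by metis
  obtain e where e: "coequalizer C p q e" using ex_coequalizer_kernel_pair pb by blast
  note P = pullbackD[OF pb f f]
  define I where "I = Cod C e"
  have eh: "e \<in> hom C A I" and epq: "e \<cdot> p = e \<cdot> q"
    using coequalizerD[OF e P(1)] unfolding I_def by blast+
  obtain m where m: "m \<in> hom C I B" "m \<cdot> e = f"
    using coequalizerD(3)[OF e P(1) f P(3)] unfolding I_def by blast
  have re: "regular_epi C e" using e regular_epi_def by metis
  have "monic C m"
  proof (rule monicI[OF m(1)])
    fix D x y assume xy: "x \<in> hom C D I" "y \<in> hom C D I" "m \<cdot> x = m \<cdot> y"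
    \<comment> \<open>Two successive pullbacks of \<open>e\<close> lift \<open>x\<close> and then \<open>y\<close>; the cover is \<open>e1 \<cdot> e2\<close>.\<close>
    obtain x' e1 where pb1: "pullback C e x x' e1" using ex_pullback homD[OF eh] homD[OF xy(1)] by metis
    note P1 = pullbackD[OF pb1 eh xy(1)]
    have re1: "regular_epi C e1" using regular_epi_stable pb1 re by blast
    define Q where "Q = Dom C x'"
    have x': "x' \<in> hom C Q A" and e1: "e1 \<in> hom C Q D" using P1 Q_def by auto
    have ye1: "y \<cdot> e1 \<in> hom C Q I" using e1 xy Comp_hom by blast
    obtain y' e2 where pb2: "pullback C e (y \<cdot> e1) y' e2"
      using ex_pullback homD[OF eh] homD[OF ye1] by metis
    note P2 = pullbackD[OF pb2 eh ye1]
    have re2: "regular_epi C e2" using regular_epi_stable pb2 re by blast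
    define R where "R = Dom C y'"
    have y': "y' \<in> hom C R A" and e2: "e2 \<in> hom C R Q" using P2 R_def by auto
    have e12: "e1 \<cdot> e2 \<in> hom C R D" using Comp_hom e1 e2 by blast
    have x'e2: "x' \<cdot> e2 \<in> hom C R A" using Comp_hom x' e2 by blast
    have a: "e \<cdot> (x' \<cdot> e2) = x \<cdot> (e1 \<cdot> e2)"
      using Comp_assoc[OF e2 x' eh] Comp_assoc[OF e2 e1 xy(1)] P1(3) by simp
    have b: "e \<cdot> y' = y \<cdot> (e1 \<cdot> e2)"
      using P2(3) Comp_assoc[OF e2 e1 xy(2)] by simp
    have "f \<cdot> (x' \<cdot> e2) = f \<cdot> y'"
      using Comp_assoc[OF x'e2 eh m(1)] Comp_assoc[OF y' eh m(1)] m(2) a b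
        Comp_assoc[OF e12 xy(1) m(1)] Comp_assoc[OF e12 xy(2) m(1)] xy(3) by simp
    then obtain u where u: "u \<in> hom C R (Dom C p)" "p \<cdot> u = x' \<cdot> e2" "q \<cdot> u = y'"
      using P(5)[OF x'e2 y'] by blast
    have "e \<cdot> (x' \<cdot> e2) = e \<cdot> y'"
      using Comp_assoc[OF u(1) P(1) eh] Comp_assoc[OF u(1) P(2) eh] u(2,3) epq by simp
    then have "x \<cdot> (e1 \<cdot> e2) = y \<cdot> (e1 \<cdot> e2)" using a b by simp
    moreover have "epic C (e1 \<cdot> e2)"
      using epic_comp[OF regular_epi_epic[OF re1] regular_epi_epic[OF re2] e2 e1] .
    ultimately show "x = y" using epicD[OF _ e12 xy(1,2)] by blast
  qed
  then show ?thesis using eh m e pb by metis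
qed

end

context semi_abelian
begin

text \<open>This is where protomodularity is used. The kernel pair \<open>E\<close> of the pairing \<open>w\<close> of \<open>e\<close> and \<open>h\<close> consists of
  the pairs identified by both, so it lies in the kernel pair \<open>R\<close> of \<open>e\<close>. Both are split epimorphisms onto
  \<open>A\<close> by their first projection, with the diagonal as section, and both projections have the kernel of \<open>e\<close>
  as their kernel, since \<open>h\<close> vanishes on it. Protomodularity makes the inclusion of \<open>E\<close> in \<open>R\<close> an
  isomorphism.\<close>

lemma kernel_pair_identified:
  assumes e: "e \<in> hom C A I" and pb: "pullback C e e p1 p2" and k: "is_kernel C e k"
    and h: "h \<in> hom C A D" "h \<cdot> k = zero_map C (Dom C k) D"
  shows "h \<cdot> p1 = h \<cdot> p2"
proof -
  define K where "K = Dom C k"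
  define R where "R = Dom C p1"
  have O: "A \<in> Obj C" "I \<in> Obj C" "D \<in> Obj C" using e h hom_Obj by blast+
  note kk = is_kernelD[OF k e, folded K_def]
  have KO: "K \<in> Obj C" using kk(1) hom_Obj by blast
  note P = pullbackD[OF pb e e, folded R_def]
  obtain Q a b where Q: "a \<in> hom C Q I" "b \<in> hom C Q D"
    and ex: "\<And>E x y. \<lbrakk>x \<in> hom C E I; y \<in> hom C E D\<rbrakk> \<Longrightarrow> \<exists>u \<in> hom C E Q. a \<cdot> u = x \<and> b \<cdot> u = y"
    and un: "\<And>E u v. \<lbrakk>u \<in> hom C E Q; v \<in> hom C E Q; a \<cdot> u = a \<cdot> v; b \<cdot> u = b \<cdot> v\<rbrakk> \<Longrightarrow> u = v"
    using ex_product[OF O(2,3)] by metis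
  have QO: "Q \<in> Obj C" using Q hom_Obj by blast
  obtain w where w: "w \<in> hom C A Q" "a \<cdot> w = e" "b \<cdot> w = h" using ex[OF e h(1)] by blast
  have kw: "is_kernel C w k"
  proof (rule is_kernelI[OF w(1) kk(1)])
    have "a \<cdot> (w \<cdot> k) = a \<cdot> zero_map C K Q"
      using Comp_assoc[OF kk(1) w(1) Q(1)] w(2) kk(2) comp_zero[OF KO Q(1)] by simp
    moreover have "b \<cdot> (w \<cdot> k) = b \<cdot> zero_map C K Q"
      using Comp_assoc[OF kk(1) w(1) Q(2)] w(3) h(2) comp_zero[OF KO Q(2)] K_def by simp
    ultimately show "w \<cdot> k = zero_map C K Q"
      using un[OF Comp_hom[OF kk(1) w(1)] zero_map_hom[OF KO QO]] by blast
    show "monic C k" using kk by blast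
    fix E t assume t: "t \<in> hom C E A" "w \<cdot> t = zero_map C E Q"
    have "e \<cdot> t = zero_map C E I"
      using Comp_assoc[OF t(1) w(1) Q(1)] w(2) t(2) comp_zero[OF _ Q(1)] hom_Obj[OF t(1)] by simp
    then show "\<exists>u \<in> hom C E K. k \<cdot> u = t" using kk(4) t by blast
  qed
  obtain q1 q2 where pbw: "pullback C w w q1 q2" using ex_pullback homD[OF w(1)] by metis
  define E where "E = Dom C q1"
  note W = pullbackD[OF pbw w(1) w(1), folded E_def]
  have "e \<cdot> q1 = e \<cdot> q2"
    using Comp_assoc[OF W(1) w(1) Q(1)] Comp_assoc[OF W(2) w(1) Q(1)] W(3) w(2) by simp
  then obtain j where j: "j \<in> hom C E R" "p1 \<cdot> j = q1" "p2 \<cdot> j = q2" using P(5)[OF W(1,2)] by blast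
  \<comment> \<open>The diagonal of \<open>E\<close>; the diagonal of \<open>R\<close> is then \<open>j \<cdot> s\<close>.\<close>
  obtain s where s: "s \<in> hom C A E" "q1 \<cdot> s = Idn C A"
    using W(5)[OF Idn_hom[OF O(1)] Idn_hom[OF O(1)]] by blast
  \<comment> \<open>The arrow \<open>x\<close> is the pairing of \<open>0\<close> and \<open>k\<close>.\<close>
  have "w \<cdot> zero_map C K A = w \<cdot> k"
    using comp_zero[OF KO w(1)] is_kernelD(2)[OF kw w(1)] K_def by simp
  then obtain x where x: "x \<in> hom C K E" "q1 \<cdot> x = zero_map C K A" "q2 \<cdot> x = k"
    using W(5)[OF zero_map_hom[OF KO O(1)] kk(1)] by blast
  have jx: "j \<cdot> x \<in> hom C K R" "p1 \<cdot> (j \<cdot> x) = zero_map C K A" "p2 \<cdot> (j \<cdot> x) = k"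
    using Comp_hom[OF x(1) j(1)] Comp_assoc[OF x(1) j(1) P(1)] Comp_assoc[OF x(1) j(1) P(2)] j x by simp_all
  have k1: "is_kernel C q1 x"
    using kernel_pair_kernel[OF w(1) pbw kw, folded K_def E_def, OF x] .
  have k2: "is_kernel C p1 (j \<cdot> x)"
    using kernel_pair_kernel[OF e pb k, folded K_def R_def, OF jx] .
  have pt1: "point C E A q1 s" using W(1) s unfolding point_def by blast
  have pt2: "point C R A p1 (j \<cdot> s)"
    using P(1) Comp_hom[OF s(1) j(1)] Comp_assoc[OF s(1) j(1) P(1)] j s unfolding point_def by simp
  note Z = Zero_zero
  note pb1 = kernel_pullback[OF k1 W(1) Z] and pb2 = kernel_pullback[OF k2 P(1) Z]
  have D1: "Dom C x = K" "Dom C (j \<cdot> x) = K" using homD[OF x(1)] homD[OF jx(1)] by auto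
  have iK: "iso C (Idn C K)"
    unfolding iso_def using homD[OF Idn_hom[OF KO]] Idn_hom[OF KO] Idn_Comp[OF Idn_hom[OF KO]] by auto
  have "iso C j"
  proof (rule protomodular[OF pt1 pt2 j(1,2) refl _ pb1 pb2])
    show "zero_map C (Zero C) A \<in> hom C (Zero C) A" using zero_map_hom[OF zero_obj_Obj[OF Z] O(1)] .
    show "Idn C K \<in> hom C (Dom C x) (Dom C (j \<cdot> x))" using D1 Idn_hom[OF KO] by simp
    show "(j \<cdot> x) \<cdot> Idn C K = j \<cdot> x" using Comp_Idn[OF jx(1)] .
    show "zero_map C (Dom C (j \<cdot> x)) (Zero C) \<cdot> Idn C K = zero_map C (Dom C x) (Zero C)"
      using D1 Comp_Idn[OF zero_map_hom[OF KO zero_obj_Obj[OF Z]]] by simp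
    show "iso C (Idn C K)" by (rule iK)
  qed
  then obtain i where i: "i \<in> hom C R E" "j \<cdot> i = Idn C R" using isoE j(1) by blast
  have "q1 \<cdot> i = p1" "q2 \<cdot> i = p2"
    using Comp_assoc[OF i(1) j(1) P(1)] Comp_assoc[OF i(1) j(1) P(2)] i(2) j(2,3)
      Comp_Idn[OF P(1)] Comp_Idn[OF P(2)] by simp_all
  moreover have "h \<cdot> q1 = h \<cdot> q2"
    using Comp_assoc[OF W(1) w(1) Q(2)] Comp_assoc[OF W(2) w(1) Q(2)] W(3) w(3) by simp
  ultimately show ?thesis
    using Comp_assoc[OF i(1) W(1) h(1)] Comp_assoc[OF i(1) W(2) h(1)] by simp
qed

text \<open>An arrow that vanishes on the kernel of \<open>f\<close> coequalizes its kernel pair, so the coequalizer of the kernel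
  pair is a cokernel of the kernel.\<close>

lemma ex_normal_epi_monic_factorization:
  assumes f: "f \<in> hom C A B"
  shows "\<exists>e m I. e \<in> hom C A I \<and> m \<in> hom C I B \<and> f = m \<cdot> e \<and> normal_epi C e \<and> monic C m"
proof -
  obtain e m I p q where *: "e \<in> hom C A I" "m \<in> hom C I B" "f = m \<cdot> e" "monic C m"
    "coequalizer C p q e" "pullback C f f p q"
    using ex_regular_epi_monic_factorization[OF f] by metis
  obtain k where k: "is_kernel C e k" using ex_kernel[OF *(1)] by blast
  note K = is_kernelD[OF k *(1)] and P = pullbackD[OF *(6) f f]
  have kf: "is_kernel C f k"
  proof (rule is_kernelI[OF f K(1)])
    show "f \<cdot> k = zero_map C (Dom C k) B"
      using *(3) Comp_assoc[OF K(1) *(1,2)] K(2) comp_zero[OF _ *(2)] hom_Obj[OF K(1)] by simp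
    show "monic C k" by (rule K(3))
    fix D h assume h: "h \<in> hom C D A" "f \<cdot> h = zero_map C D B"
    then have "e \<cdot> h = zero_map C D I"
      using zero_cancel_monic[OF *(4,2) Comp_hom[OF h(1) *(1)]] *(3) Comp_assoc[OF h(1) *(1,2)] by simp
    then show "\<exists>u \<in> hom C D (Dom C k). k \<cdot> u = h" using K(4) h by blast
  qed
  have "is_cokernel C k e"
  proof (rule is_cokernelI[OF K(1) *(1) K(2)])
    show "epic C e" using regular_epi_epic *(5) regular_epi_def by metis
    fix D h assume h: "h \<in> hom C A D" "h \<cdot> k = zero_map C (Dom C k) D"
    have "h \<cdot> p = h \<cdot> q" using kernel_pair_identified[OF f *(6) kf h] .
    then show "\<exists>u \<in> hom C I D. u \<cdot> e = h"
      using coequalizerD(3)[OF *(5) P(1) h(1)] homD[OF *(1)] by simp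
  qed
  then have "normal_epi C e" by (auto simp: normal_epi_def)
  then show ?thesis using * by blast
qed

text \<open>Factor an arrow with kernel \<open>m\<close>: its normal epi part has the same kernel and is therefore the
  cokernel of \<open>m\<close>.\<close>

lemma normal_mono_short_exact:
  assumes "normal_mono C m" "m \<in> hom C I B"
  shows "\<exists>c. short_exact C m c"
proof -
  obtain f where f: "is_kernel C f m" using assms normal_mono_def by metis
  define D where "D = Cod C f"
  have fh: "f \<in> hom C B D" using f homD[OF assms(2)] unfolding is_kernel_def D_def hom_def by auto
  obtain e n J where *: "e \<in> hom C B J" "n \<in> hom C J D" "f = n \<cdot> e" "normal_epi C e" "monic C n"
    using ex_normal_epi_monic_factorization[OF fh] by metis
  note K = is_kernelD[OF f fh]
  have DI: "Dom C m = I" using homD[OF assms(2)] by simp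
  have IO: "I \<in> Obj C" using assms hom_Obj by blast
  have "is_kernel C e m"
  proof (rule is_kernelI[OF *(1) K(1)])
    show "e \<cdot> m = zero_map C (Dom C m) J"
      using zero_cancel_monic[OF *(5,2) Comp_hom[OF K(1) *(1)]] *(3) Comp_assoc[OF K(1) *(1,2)] K(2) by simp
    show "monic C m" by (rule K(3))
    fix E h assume h: "h \<in> hom C E B" "e \<cdot> h = zero_map C E J"
    then have "f \<cdot> h = zero_map C E D"
      using *(3) Comp_assoc[OF h(1) *(1,2)] comp_zero[OF _ *(2)] hom_Obj[OF h(1)] by simp
    then show "\<exists>u \<in> hom C E (Dom C m). m \<cdot> u = h" using K(4) h by blast
  qed
  then show ?thesis using normal_epi_cokernel_of_kernel[OF *(4)] short_exact_def by metis
qed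

end

section \<open>Torsion theories in full subcategories\<close>

lemma full_subcat_simps [simp]:
  "Obj (full_subcat C D) = Obj C \<inter> D"
  "Dom (full_subcat C D) = Dom C" "Cod (full_subcat C D) = Cod C"
  "Idn (full_subcat C D) = Idn C" "Comp (full_subcat C D) = Comp C"
  by (simp_all add: full_subcat_def)

lemma full_subcat_hom [simp]:
  "f \<in> hom (full_subcat C D) A B \<longleftrightarrow> f \<in> hom C A B \<and> A \<in> D \<and> B \<in> D"
  by (auto simp: full_subcat_def hom_def)

lemma full_subcat_UNIV [simp]: "full_subcat C UNIV = C"
  by (simp add: full_subcat_def)

lemma replete_full_subcat:
  assumes "replete C S"
  shows "replete (full_subcat C D) (S \<inter> D)"
  using assms unfolding replete_def iso_def by (auto simp: full_subcat_def hom_def)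

lemma (in category) category_full_subcat: "category (full_subcat C D)"
proof
  show "Dom (full_subcat C D) f \<in> Obj (full_subcat C D)"
    and "Cod (full_subcat C D) f \<in> Obj (full_subcat C D)" if "f \<in> Arr (full_subcat C D)" for f
    using that Dom_Obj Cod_Obj by (auto simp: full_subcat_def)
qed (use Idn_hom Comp_hom Comp_Idn Idn_Comp Comp_assoc in \<open>simp; blast\<close>)+

context pointed_category
begin

lemma zero_obj_full_subcat:
  assumes "zero_obj C Z" "Z \<in> D"
  shows "zero_obj (full_subcat C D) Z"
  using assms unfolding zero_obj_def by simp

lemma pointed_full_subcat:
  assumes "zero_obj C Z" "Z \<in> D"
  shows "pointed_category (full_subcat C D)"
  using zero_obj_full_subcat[OF assms] category_full_subcat[of D]
  unfolding pointed_category_def pointed_category_axioms_def by blast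

text \<open>The zero object \<open>Z\<close> of \<open>C\<close> is also one of the full subcategory, and the zero arrow of either category
  factors through it.\<close>

lemma zero_map_full_subcat:
  assumes Z: "zero_obj C Z" "Z \<in> D" and A: "A \<in> Obj C" "A \<in> D" and B: "B \<in> Obj C" "B \<in> D"
  shows "zero_map (full_subcat C D) A B = zero_map C A B"
proof -
  interpret F: pointed_category "full_subcat C D" using pointed_full_subcat Z .
  note ZO = zero_obj_Obj[OF Z(1)]
  have "zero_map (full_subcat C D) Z B = zero_map C Z B"
    using zero_obj_hom_eq(2)[OF Z(1), of _ B] F.zero_map_hom[of Z B] zero_map_hom[OF ZO B(1)] ZO Z B by simp
  moreover have "zero_map (full_subcat C D) Z B \<cdot> zero_map C A Z = zero_map (full_subcat C D) A B"
    using F.zero_comp[of B "zero_map C A Z" A Z] B A Z zero_map_hom[OF A(1) ZO] by simp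
  ultimately show ?thesis using zero_comp[OF B(1) zero_map_hom[OF A(1) ZO]] by simp
qed

lemma short_exact_full_subcat:
  assumes Z: "zero_obj C Z" "Z \<in> D" and D: "A \<in> D" "M \<in> D" "B \<in> D"
    and k: "k \<in> hom C A M" and p: "p \<in> hom C M B" and se: "short_exact C k p"
  shows "short_exact (full_subcat C D) k p"
proof -
  interpret F: pointed_category "full_subcat C D" using pointed_full_subcat Z .
  note O = hom_Obj[OF k] hom_Obj[OF p]
  have ker: "is_kernel C p k" and cok: "is_cokernel C k p" using se short_exact_def by metis+
  note K = is_kernelD[OF ker p, unfolded homD[OF k]] and Q = is_cokernelD[OF cok k, unfolded homD[OF p]]
  note zm = zero_map_full_subcat[OF Z]
  have "is_kernel (full_subcat C D) p k"
  proof (rule F.is_kernelI)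
    show "p \<in> hom (full_subcat C D) M B" "k \<in> hom (full_subcat C D) A M" using k p D by simp_all
    show "p \<cdot>\<^bsub>full_subcat C D\<^esub> k = zero_map (full_subcat C D) A B" using K(2) zm O D by simp
    show "monic (full_subcat C D) k"
      by (rule F.monicI[of k A M]) (use k D monicD[OF K(3) k] in \<open>simp; blast\<close>)+
    fix E h assume "h \<in> hom (full_subcat C D) E M"
      "p \<cdot>\<^bsub>full_subcat C D\<^esub> h = zero_map (full_subcat C D) E B"
    then show "\<exists>u \<in> hom (full_subcat C D) E A. k \<cdot>\<^bsub>full_subcat C D\<^esub> u = h"
      using K(4)[of h E] zm[of E B] hom_Obj[of h E M] O D by auto
  qed
  moreover have "is_cokernel (full_subcat C D) k p"
  proof (rule F.is_cokernelI)
    show "p \<in> hom (full_subcat C D) M B" "k \<in> hom (full_subcat C D) A M" using k p D by simp_all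
    show "p \<cdot>\<^bsub>full_subcat C D\<^esub> k = zero_map (full_subcat C D) A B" using K(2) zm O D by simp
    show "epic (full_subcat C D) p"
      by (rule F.epicI[of p M B]) (use p D epicD[OF Q(3) p] in \<open>simp; blast\<close>)+
    fix E h assume "h \<in> hom (full_subcat C D) M E"
      "h \<cdot>\<^bsub>full_subcat C D\<^esub> k = zero_map (full_subcat C D) A E"
    then show "\<exists>u \<in> hom (full_subcat C D) B E. u \<cdot>\<^bsub>full_subcat C D\<^esub> p = h"
      using Q(4)[of h E] zm[of A E] hom_Obj[of h M E] O D by auto
  qed
  ultimately show ?thesis by (simp add: short_exact_def)
qed

text \<open>The ambient category is the case in which \<open>D\<close> is everything, so that this criterion serves all complexes and
  proper complexes alike.\<close>

lemma torsion_theory_full_subcat: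
  assumes Z: "zero_obj C Z" "Z \<in> D"
    and TF: "T \<subseteq> Obj C" "F \<subseteq> Obj C" "replete C T" "replete C F"
    and orth: "\<And>A B f. \<lbrakk>A \<in> T; B \<in> F; f \<in> hom C A B\<rbrakk> \<Longrightarrow> f = zero_map C A B"
    and ex: "\<And>X. \<lbrakk>X \<in> Obj C; X \<in> D\<rbrakk> \<Longrightarrow>
      \<exists>A \<in> T \<inter> D. \<exists>B \<in> F \<inter> D. \<exists>k \<in> hom C A X. \<exists>p \<in> hom C X B. short_exact C k p"
  shows "torsion_theory (full_subcat C D) (T \<inter> D) (F \<inter> D)"
proof -
  interpret F: pointed_category "full_subcat C D" using pointed_full_subcat Z .
  show ?thesis unfolding torsion_theory_def
  proof (intro conjI ballI)
    show "pointed_category (full_subcat C D)" by unfold_locales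
    show "T \<inter> D \<subseteq> Obj (full_subcat C D)" "F \<inter> D \<subseteq> Obj (full_subcat C D)" using TF by auto
    show "replete (full_subcat C D) (T \<inter> D)" "replete (full_subcat C D) (F \<inter> D)"
      using replete_full_subcat TF by blast+
    show "zero_arr (full_subcat C D) f"
      if "A \<in> T \<inter> D" "B \<in> F \<inter> D" "f \<in> hom (full_subcat C D) A B" for A B f
      using F.zero_arr_iff[OF that(3)] orth[of A B f] zero_map_full_subcat[OF Z, of A B]
        subsetD[OF TF(1), of A] subsetD[OF TF(2), of B] that by simp
    fix X assume X: "X \<in> Obj (full_subcat C D)"
    then obtain A B k p where *: "A \<in> T \<inter> D" "B \<in> F \<inter> D" "k \<in> hom C A X" "p \<in> hom C X B"
      "short_exact C k p" using ex[of X] by auto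
    then have "short_exact (full_subcat C D) k p"
      using short_exact_full_subcat[OF Z _ _ _ *(3-5)] X by simp
    then show "\<exists>A \<in> T \<inter> D. \<exists>B \<in> F \<inter> D. \<exists>k \<in> hom (full_subcat C D) A X.
        \<exists>p \<in> hom (full_subcat C D) X B. short_exact (full_subcat C D) k p"
      using * X by (intro bexI[of _ A] bexI[of _ B] bexI[of _ k] bexI[of _ p]) auto
  qed
qed

end

section \<open>Proper arrows\<close>

text \<open>The condition that properness of a complex imposes on each of its differentials.\<close>

definition proper_arrow :: "('o, 'm) cat \<Rightarrow> 'm \<Rightarrow> bool" where
  "proper_arrow C d \<longleftrightarrow> (\<exists>e m. normal_epi C e \<and> monic C m \<and> Cod C e = Dom C m \<and>
     d = m \<cdot>\<^bsub>C\<^esub> e \<and> normal_mono C m)"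

lemma proper_chain_iff:
  "proper_chain C M \<longleftrightarrow> chain_complex C M \<and> (\<forall>i. proper_arrow C (bd M i))"
  by (simp add: proper_chain_def proper_arrow_def)

context pointed_category
begin

lemma normal_epiE:
  assumes "normal_epi C e" "e \<in> hom C A I"
  obtains f K where "f \<in> hom C K A" "is_cokernel C f e"
proof -
  obtain f where f: "is_cokernel C f e" using assms normal_epi_def by metis
  then have "f \<in> hom C (Dom C f) A" using homD[OF assms(2)] unfolding is_cokernel_def hom_def by auto
  then show ?thesis using that f by blast
qed

lemma normal_epi_epic: "normal_epi C e \<Longrightarrow> epic C e"
  using is_cokernelD(3) homI unfolding normal_epi_def is_cokernel_def by metis

lemma normal_monoE:
  assumes "normal_mono C m" "m \<in> hom C I B"
  obtains f Q where "f \<in> hom C B Q" "is_kernel C f m"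
proof -
  obtain f where f: "is_kernel C f m" using assms normal_mono_def by metis
  then have "f \<in> hom C B (Cod C f)" using homD[OF assms(2)] unfolding is_kernel_def hom_def by auto
  then show ?thesis using that f by blast
qed

lemma short_exact_normal:
  assumes "short_exact C k p"
  shows "normal_mono C k" "normal_epi C p"
  using assms unfolding short_exact_def normal_mono_def normal_epi_def by blast+

lemma proper_arrowE:
  assumes "proper_arrow C d" "d \<in> hom C A B"
  obtains e m I where "e \<in> hom C A I" "m \<in> hom C I B" "d = m \<cdot> e" "normal_epi C e" "epic C e"
    "normal_mono C m" "monic C m"
proof -
  obtain e m where *: "normal_epi C e" "monic C m" "Cod C e = Dom C m" "d = m \<cdot> e" "normal_mono C m"
    using assms proper_arrow_def by metis
  have e: "epic C e" using normal_epi_epic * by blast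
  have eh: "e \<in> hom C (Dom C e) (Dom C m)" using e *(3) unfolding epic_def hom_def by simp
  have mh: "m \<in> hom C (Dom C m) (Cod C m)" using *(2) unfolding monic_def hom_def by simp
  have "Dom C e = A" "Cod C m = B"
    using homD[OF Comp_hom[OF eh mh]] *(4) homD[OF assms(2)] by auto
  then show ?thesis using that[of e "Dom C m" m] eh mh * e by auto
qed

lemma proper_arrowI:
  assumes "e \<in> hom C A I" "m \<in> hom C I B" "d = m \<cdot> e" "normal_epi C e" "normal_mono C m" "monic C m"
  shows "proper_arrow C d"
  unfolding proper_arrow_def using assms homD[OF assms(1)] homD[OF assms(2)] by metis

lemma proper_arrow_zero:
  assumes "d \<in> hom C A B" "zero_obj C A \<or> zero_obj C B"
  shows "proper_arrow C d"
proof -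
  note O = hom_Obj[OF assms(1)] and Z = Zero_zero
  note ZO = zero_obj_Obj[OF Z]
  have "d = zero_map C (Zero C) B \<cdot> zero_map C A (Zero C)"
    using hom_zero_obj[OF assms] zero_comp[OF _ zero_map_hom[OF _ ZO]] O by simp
  then show ?thesis
    using proper_arrowI[OF zero_map_hom[OF _ ZO] zero_map_hom[OF ZO]] O
      short_exact_normal(2)[OF short_exact_Idn_zero[OF _ Z]]
      short_exact_normal(1)[OF short_exact_zero_Idn[OF _ Z]] zero_map_from_zero_monic[OF _ Z] by blast
qed

text \<open>If \<open>k \<cdot> d = m \<cdot> e\<close> with \<open>m\<close> the kernel of \<open>g\<close>, then \<open>d\<close> kills whatever \<open>e\<close> is the cokernel of, so it factors
  as \<open>n \<cdot> e\<close>, and \<open>n\<close> is the kernel of \<open>g \<cdot> k\<close>.\<close>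

lemma proper_arrow_corestrict:
  assumes pr: "proper_arrow C (k \<cdot> d)" and d: "d \<in> hom C A B" and k: "k \<in> hom C B D" "monic C k"
  shows "proper_arrow C d"
proof -
  obtain e m I where *: "e \<in> hom C A I" "m \<in> hom C I D" "k \<cdot> d = m \<cdot> e" "normal_epi C e" "epic C e"
    "normal_mono C m" "monic C m"
    using proper_arrowE[OF pr Comp_hom[OF d k(1)]] by metis
  obtain f K where f: "f \<in> hom C K A" "is_cokernel C f e" using normal_epiE * by blast
  note Q = is_cokernelD[OF f(2,1), unfolded homD[OF *(1)]]
  have "k \<cdot> (d \<cdot> f) = zero_map C K D"
    using Comp_assoc[OF f(1) d k(1)] Comp_assoc[OF f(1) *(1,2)] *(3) Q(2) comp_zero[OF _ *(2)]
      hom_Obj[OF f(1)] by simp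
  then have "d \<cdot> f = zero_map C K B" using zero_cancel_monic[OF k(2,1) Comp_hom[OF f(1) d]] by blast
  then obtain n where n: "n \<in> hom C I B" "n \<cdot> e = d" using Q(4) d by blast
  have "(k \<cdot> n) \<cdot> e = m \<cdot> e" using Comp_assoc[OF *(1) n(1) k(1)] n *(3) by simp
  then have kn: "k \<cdot> n = m" using epicD[OF *(5,1) Comp_hom[OF n(1) k(1)] *(2)] by blast
  then have mn: "monic C n" using monic_comp_cancel[OF _ n(1) k(1)] *(7) by simp
  obtain g G where g: "g \<in> hom C D G" "is_kernel C g m" using normal_monoE * by blast
  note Km = is_kernelD[OF g(2,1), unfolded homD[OF *(2)]]
  have "is_kernel C (g \<cdot> k) n"
  proof (rule is_kernelI[OF Comp_hom[OF k(1) g(1)] n(1) _ mn])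
    show "(g \<cdot> k) \<cdot> n = zero_map C I G" using Comp_assoc[OF n(1) k(1) g(1)] kn Km(2) by simp
    fix E h assume h: "h \<in> hom C E B" "(g \<cdot> k) \<cdot> h = zero_map C E G"
    then obtain u where u: "u \<in> hom C E I" "m \<cdot> u = k \<cdot> h"
      using Km(4)[OF Comp_hom[OF h(1) k(1)]] Comp_assoc[OF h(1) k(1) g(1)] by auto
    then have "k \<cdot> (n \<cdot> u) = k \<cdot> h" using Comp_assoc[OF u(1) n(1) k(1)] kn by simp
    then have "n \<cdot> u = h" using monicD[OF k(2,1) Comp_hom[OF u(1) n(1)] h(1)] by blast
    then show "\<exists>u \<in> hom C E I. n \<cdot> u = h" using u by blast
  qed
  then have "normal_mono C n" by (auto simp: normal_mono_def)
  then show ?thesis using proper_arrowI[OF *(1) n(1)] n(2) *(4) mn by simp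
qed

text \<open>If \<open>d \<cdot> p = m \<cdot> e\<close> with \<open>e\<close> the cokernel of \<open>g\<close>, then \<open>e\<close> factors as \<open>n \<cdot> p\<close> since \<open>m\<close> is monic, and \<open>n\<close> is the
  cokernel of \<open>p \<cdot> g\<close>.\<close>

lemma proper_arrow_factor_epi:
  assumes pr: "proper_arrow C (d \<cdot> p)" and d: "d \<in> hom C A B" and p: "p \<in> hom C E A" "normal_epi C p"
  shows "proper_arrow C d"
proof -
  obtain e m I where *: "e \<in> hom C E I" "m \<in> hom C I B" "d \<cdot> p = m \<cdot> e" "normal_epi C e" "epic C e"
    "normal_mono C m" "monic C m"
    using proper_arrowE[OF pr Comp_hom[OF p(1) d]] by metis
  obtain f K where f: "f \<in> hom C K E" "is_cokernel C f p" using normal_epiE p by blast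
  note Q = is_cokernelD[OF f(2,1), unfolded homD[OF p(1)]]
  have "m \<cdot> (e \<cdot> f) = zero_map C K B"
    using Comp_assoc[OF f(1) p(1) d] Comp_assoc[OF f(1) *(1,2)] *(3) Q(2) comp_zero[OF _ d]
      hom_Obj[OF f(1)] by simp
  then have "e \<cdot> f = zero_map C K I" using zero_cancel_monic[OF *(7,2) Comp_hom[OF f(1) *(1)]] by blast
  then obtain n where n: "n \<in> hom C A I" "n \<cdot> p = e" using Q(4) *(1) by blast
  have "(m \<cdot> n) \<cdot> p = d \<cdot> p" using Comp_assoc[OF p(1) n(1) *(2)] n *(3) by simp
  then have mn: "m \<cdot> n = d" using epicD[OF Q(3) p(1) Comp_hom[OF n(1) *(2)] d] by blast
  obtain g G where g: "g \<in> hom C G E" "is_cokernel C g e" using normal_epiE * by blast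
  note Qe = is_cokernelD[OF g(2,1), unfolded homD[OF *(1)]]
  have "is_cokernel C (p \<cdot> g) n"
  proof (rule is_cokernelI[OF Comp_hom[OF g(1) p(1)] n(1)])
    show "n \<cdot> (p \<cdot> g) = zero_map C G I" using Comp_assoc[OF g(1) p(1) n(1)] n(2) Qe(2) by simp
    show "epic C n"
    proof (rule epicI[OF n(1)])
      fix D u v assume uv: "u \<in> hom C I D" "v \<in> hom C I D" "u \<cdot> n = v \<cdot> n"
      then have "u \<cdot> e = v \<cdot> e"
        using Comp_assoc[OF p(1) n(1) uv(1)] Comp_assoc[OF p(1) n(1) uv(2)] n(2) by simp
      then show "u = v" using epicD[OF *(5,1) uv(1,2)] by blast
    qed
    fix D h assume h: "h \<in> hom C A D" "h \<cdot> (p \<cdot> g) = zero_map C G D"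
    then obtain u where u: "u \<in> hom C I D" "u \<cdot> e = h \<cdot> p"
      using Qe(4)[OF Comp_hom[OF p(1) h(1)]] Comp_assoc[OF g(1) p(1) h(1)] by auto
    then have "(u \<cdot> n) \<cdot> p = h \<cdot> p" using Comp_assoc[OF p(1) n(1) u(1)] n(2) by simp
    then have "u \<cdot> n = h" using epicD[OF Q(3) p(1) Comp_hom[OF n(1) u(1)] h(1)] by blast
    then show "\<exists>u \<in> hom C I D. u \<cdot> n = h" using u by blast
  qed
  then have "normal_epi C n" by (auto simp: normal_epi_def)
  then show ?thesis using proper_arrowI[OF n(1) *(2)] mn * by simp
qed

end

section \<open>The category of chain complexes\<close>

lemma chn_simps [simp]:
  "Obj (chn C) = {M. chain_complex C M}" "Arr (chn C) = {f. is_chain_map C f}"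
  "Dom (chn C) = src" "Cod (chn C) = tgt"
  by (simp_all add: chn_def)

lemma cmp_Comp [simp]: "cmp (Comp (chn C) g f) i = Comp C (cmp g i) (cmp f i)"
  and cmp_Idn [simp]: "cmp (Idn (chn C) M) i = Idn C (ob M i)"
  by (simp_all add: chn_def)

lemma chn_homI:
  assumes "chain_complex C M" "chain_complex C N" "\<And>i. a i \<in> hom C (ob M i) (ob N i)"
    "\<And>i. a (i - 1) \<cdot>\<^bsub>C\<^esub> bd M i = bd N i \<cdot>\<^bsub>C\<^esub> a i"
  shows "ChainMap M a N \<in> hom (chn C) M N"
  using assms by (simp add: hom_def is_chain_map_def)

lemma chn_homD:
  assumes "f \<in> hom (chn C) M N"
  shows "chain_complex C M" "chain_complex C N" "cmp f i \<in> hom C (ob M i) (ob N i)"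
    "cmp f (i - 1) \<cdot>\<^bsub>C\<^esub> bd M i = bd N i \<cdot>\<^bsub>C\<^esub> cmp f i" "src f = M" "tgt f = N"
  using assms by (auto simp: hom_def is_chain_map_def)

lemma chn_hom_eqI:
  assumes "f \<in> hom (chn C) M N" "g \<in> hom (chn C) M N" "\<And>i. cmp f i = cmp g i"
  shows "f = g"
  using assms chn_homD(5,6)[OF assms(1)] chn_homD(5,6)[OF assms(2)]
  by (cases f; cases g) auto

lemma chain_complexD:
  assumes "chain_complex C M"
  shows "ob M i \<in> Obj C" "bd M i \<in> hom C (ob M i) (ob M (i - 1))"
    "bd M (i + 1) \<in> hom C (ob M (i + 1)) (ob M i)"
    "zero_arr C (bd M i \<cdot>\<^bsub>C\<^esub> bd M (i + 1))"
proof -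
  show "ob M i \<in> Obj C" "bd M i \<in> hom C (ob M i) (ob M (i - 1))"
    "zero_arr C (bd M i \<cdot>\<^bsub>C\<^esub> bd M (i + 1))"
    using assms unfolding chain_complex_def by blast+
  have "bd M (i + 1) \<in> hom C (ob M (i + 1)) (ob M (i + 1 - 1))"
    using assms unfolding chain_complex_def by blast
  then show "bd M (i + 1) \<in> hom C (ob M (i + 1)) (ob M i)" by simp
qed

text \<open>The disc has the object \<open>D\<close> in degrees \<open>i\<close> and \<open>i - 1\<close>, joined by the identity. Chain maps out
  of it into \<open>M\<close> are the arrows \<open>D \<rightarrow> M\<^sub>i\<close>, which is why monomorphisms of complexes are monic in each
  degree.\<close>

definition disc :: "('o, 'm) cat \<Rightarrow> int \<Rightarrow> 'o \<Rightarrow> ('o, 'm) chain" where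
  "disc C i D = (let A = (\<lambda>j. if j = i \<or> j = i - 1 then D else Zero C) in
     Chain A (\<lambda>j. if j = i then Idn C D else zero_map C (A j) (A (j - 1))))"

definition disc_map :: "('o, 'm) cat \<Rightarrow> int \<Rightarrow> 'o \<Rightarrow> ('o, 'm) chain \<Rightarrow> 'm \<Rightarrow> ('o, 'm) chain_map" where
  "disc_map C i D M u = ChainMap (disc C i D)
     (\<lambda>j. if j = i then u else if j = i - 1 then bd M i \<cdot>\<^bsub>C\<^esub> u else zero_map C (Zero C) (ob M j)) M"

context pointed_category
begin

lemma bd_bd: "chain_complex C M \<Longrightarrow> bd M i \<cdot> bd M (i + 1) = zero_map C (ob M (i + 1)) (ob M (i - 1))"
  using chain_complexD[of C M i] zero_arr_iff[OF Comp_hom] by blast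

lemma chain_complexI:
  assumes d: "\<And>i. bd M i \<in> hom C (ob M i) (ob M (i - 1))"
    and dd: "\<And>i. bd M i \<cdot> bd M (i + 1) = zero_map C (ob M (i + 1)) (ob M (i - 1))"
  shows "chain_complex C M"
  unfolding chain_complex_def
proof (intro allI conjI)
  fix i
  show "bd M i \<in> hom C (ob M i) (ob M (i - 1))" by (rule d)
  then show "ob M i \<in> Obj C" using hom_Obj by blast
  have "ob M (i + 1) \<in> Obj C" "ob M (i - 1) \<in> Obj C" using d[of i] d[of "i + 1"] hom_Obj by blast+
  then show "zero_arr C (bd M i \<cdot> bd M (i + 1))" using dd zero_map_props by simp
qed

lemma category_chn: "category (chn C)"
proof
  show "Dom (chn C) f \<in> Obj (chn C)" "Cod (chn C) f \<in> Obj (chn C)" if "f \<in> Arr (chn C)" for f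
    using that by (auto simp: is_chain_map_def)
  show "Idn (chn C) M \<in> hom (chn C) M M" if "M \<in> Obj (chn C)" for M
  proof -
    have M: "chain_complex C M" using that by simp
    have "Idn (chn C) M = ChainMap M (\<lambda>i. Idn C (ob M i)) M" by (simp add: chn_def)
    then show ?thesis
      using chn_homI[OF M M, of "\<lambda>i. Idn C (ob M i)"] Idn_hom chain_complexD[OF M]
        Idn_Comp[OF chain_complexD(2)[OF M]] Comp_Idn[OF chain_complexD(2)[OF M]] by simp
  qed
  show Ch: "g \<cdot>\<^bsub>chn C\<^esub> f \<in> hom (chn C) M P" if f: "f \<in> hom (chn C) M N" and g: "g \<in> hom (chn C) N P"
    for f g M N P
  proof -
    note F = chn_homD[OF f] and G = chn_homD[OF g]
    have "g \<cdot>\<^bsub>chn C\<^esub> f = ChainMap M (\<lambda>i. cmp g i \<cdot> cmp f i) P" using F(5) G(6) by (simp add: chn_def)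
    moreover have "ChainMap M (\<lambda>i. cmp g i \<cdot> cmp f i) P \<in> hom (chn C) M P"
    proof (rule chn_homI[OF F(1) G(2)])
      show "cmp g i \<cdot> cmp f i \<in> hom C (ob M i) (ob P i)" for i using Comp_hom F(3) G(3) by blast
      show "(cmp g (i - 1) \<cdot> cmp f (i - 1)) \<cdot> bd M i = bd P i \<cdot> (cmp g i \<cdot> cmp f i)" for i
        using Comp_assoc[OF chain_complexD(2)[OF F(1)] F(3) G(3)]
          Comp_assoc[OF F(3) chain_complexD(2)[OF F(2)] G(3)]
          Comp_assoc[OF F(3) G(3) chain_complexD(2)[OF G(2)]] F(4) G(4) by simp
    qed
    ultimately show ?thesis by simp
  qed
  have I: "Idn (chn C) M \<in> hom (chn C) M M" if "chain_complex C M" for M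
    using \<open>\<And>M. M \<in> Obj (chn C) \<Longrightarrow> Idn (chn C) M \<in> hom (chn C) M M\<close> that by simp
  show "f \<cdot>\<^bsub>chn C\<^esub> Idn (chn C) M = f" if f: "f \<in> hom (chn C) M N" for f M N
    using chn_hom_eqI[OF Ch[OF I[OF chn_homD(1)[OF f]] f] f] Comp_Idn[OF chn_homD(3)[OF f]] by simp
  show "Idn (chn C) N \<cdot>\<^bsub>chn C\<^esub> f = f" if f: "f \<in> hom (chn C) M N" for f M N
    using chn_hom_eqI[OF Ch[OF f I[OF chn_homD(2)[OF f]]] f] Idn_Comp[OF chn_homD(3)[OF f]] by simp
  show "(h \<cdot>\<^bsub>chn C\<^esub> g) \<cdot>\<^bsub>chn C\<^esub> f = h \<cdot>\<^bsub>chn C\<^esub> (g \<cdot>\<^bsub>chn C\<^esub> f)"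
    if f: "f \<in> hom (chn C) M N" and g: "g \<in> hom (chn C) N P" and h: "h \<in> hom (chn C) P Q"
    for f g h M N P Q
    using chn_hom_eqI[OF Ch[OF f Ch[OF g h]] Ch[OF Ch[OF f g] h]]
      Comp_assoc[OF chn_homD(3)[OF f] chn_homD(3)[OF g] chn_homD(3)[OF h]] by simp
qed

lemma zero_chain_map_hom:
  assumes "chain_complex C M" "chain_complex C N"
  shows "ChainMap M (\<lambda>i. zero_map C (ob M i) (ob N i)) N \<in> hom (chn C) M N"
  using chn_homI[OF assms, of "\<lambda>i. zero_map C (ob M i) (ob N i)"] zero_map_hom
    chain_complexD[OF assms(1)] chain_complexD[OF assms(2)]
    zero_comp[OF chain_complexD(1)[OF assms(2)] chain_complexD(2)[OF assms(1)]]
    comp_zero[OF chain_complexD(1)[OF assms(1)] chain_complexD(2)[OF assms(2)]] by simp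

lemma zero_obj_chnI:
  assumes M: "chain_complex C M" and z: "\<And>i. zero_obj C (ob M i)"
  shows "zero_obj (chn C) M"
  unfolding zero_obj_def
proof (intro conjI ballI)
  show "M \<in> Obj (chn C)" using M by simp
  fix N assume "N \<in> Obj (chn C)"
  then have N: "chain_complex C N" by simp
  have "f = g" if "f \<in> hom (chn C) N M" "g \<in> hom (chn C) N M" for f g
    using chn_hom_eqI[OF that] zero_obj_hom_eq(1)[OF z chn_homD(3)[OF that(1)] chn_homD(3)[OF that(2)]] by blast
  then show "\<exists>!f. f \<in> hom (chn C) N M" using zero_chain_map_hom[OF N M] by blast
  have "f = g" if "f \<in> hom (chn C) M N" "g \<in> hom (chn C) M N" for f g
    using chn_hom_eqI[OF that] zero_obj_hom_eq(2)[OF z chn_homD(3)[OF that(1)] chn_homD(3)[OF that(2)]] by blast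
  then show "\<exists>!f. f \<in> hom (chn C) M N" using zero_chain_map_hom[OF M N] by blast
qed

definition zero_chain :: "('a, 'b) chain" where
  "zero_chain = Chain (\<lambda>_. Zero C) (\<lambda>_. zero_map C (Zero C) (Zero C))"

lemma zero_chain_simps [simp]:
  "ob zero_chain i = Zero C" "bd zero_chain i = zero_map C (Zero C) (Zero C)"
  by (simp_all add: zero_chain_def)

lemma zero_chain: "chain_complex C zero_chain" "zero_obj (chn C) zero_chain"
proof -
  have Z: "Zero C \<in> Obj C" using Zero_zero zero_obj_Obj by blast
  show "chain_complex C zero_chain"
    by (rule chain_complexI) (use Z zero_map_hom comp_zero in auto)
  then show "zero_obj (chn C) zero_chain" using zero_obj_chnI Zero_zero by simp
qed

lemma proper_zero_chain: "proper_chain C zero_chain"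
proof -
  have "zero_map C (Zero C) (Zero C) \<in> hom C (Zero C) (Zero C)"
    using Zero_zero zero_obj_Obj zero_map_hom by blast
  then show ?thesis
    using proper_arrow_zero Zero_zero by (simp add: proper_chain_iff zero_chain)
qed

lemma pointed_chn: "pointed_category (chn C)"
  using category_chn zero_chain(2) by (auto simp: pointed_category_def pointed_category_axioms_def)

lemma zero_map_chn:
  assumes "chain_complex C M" "chain_complex C N"
  shows "zero_map (chn C) M N = ChainMap M (\<lambda>i. zero_map C (ob M i) (ob N i)) N"
proof -
  interpret Ch: pointed_category "chn C" by (rule pointed_chn)
  note Z = zero_chain
  let ?f = "ChainMap M (\<lambda>i. zero_map C (ob M i) (ob zero_chain i)) zero_chain"
  let ?g = "ChainMap zero_chain (\<lambda>i. zero_map C (ob zero_chain i) (ob N i)) N"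
  have f: "?f \<in> hom (chn C) M zero_chain" and g: "?g \<in> hom (chn C) zero_chain N"
    using zero_chain_map_hom assms Z by blast+
  have "?f = zero_map (chn C) M zero_chain" using Ch.hom_zero_obj[OF f] Z by blast
  then have "zero_map (chn C) M N = ?g \<cdot>\<^bsub>chn C\<^esub> ?f"
    using Ch.comp_zero[OF _ g] assms by simp
  also have "\<dots> = ChainMap M (\<lambda>i. zero_map C (ob M i) (ob N i)) N"
  proof (rule chn_hom_eqI[OF Ch.Comp_hom[OF f g] zero_chain_map_hom[OF assms]])
    fix i
    have "ob M i \<in> Obj C" "ob N i \<in> Obj C" "Zero C \<in> Obj C"
      using assms chain_complexD Zero_zero zero_obj_Obj by blast+
    then show "cmp (?g \<cdot>\<^bsub>chn C\<^esub> ?f) i = cmp (ChainMap M (\<lambda>i. zero_map C (ob M i) (ob N i)) N) i"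
      using comp_zero zero_map_hom by simp
  qed
  finally show ?thesis .
qed

lemma chn_eq_zero_iff:
  assumes "f \<in> hom (chn C) M N"
  shows "f = zero_map (chn C) M N \<longleftrightarrow> (\<forall>i. cmp f i = zero_map C (ob M i) (ob N i))"
  using zero_map_chn[OF chn_homD(1,2)[OF assms]] chn_homD(5,6)[OF assms] by (cases f) auto

lemma iso_chn_cmp:
  assumes "iso (chn C) f" "f \<in> hom (chn C) M N"
  shows "iso C (cmp f i)"
proof -
  interpret Ch: pointed_category "chn C" by (rule pointed_chn)
  obtain g where g: "g \<in> hom (chn C) N M" "g \<cdot>\<^bsub>chn C\<^esub> f = Idn (chn C) M" "f \<cdot>\<^bsub>chn C\<^esub> g = Idn (chn C) N"
    using Ch.isoE assms by blast
  have "cmp g i \<cdot> cmp f i = Idn C (ob M i)" "cmp f i \<cdot> cmp g i = Idn C (ob N i)"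
    using arg_cong[OF g(2), of "\<lambda>f. cmp f i"] arg_cong[OF g(3), of "\<lambda>f. cmp f i"] by simp_all
  then show ?thesis
    using chn_homD(3)[OF g(1), of i] homD[OF chn_homD(3)[OF assms(2), of i]] unfolding iso_def by auto
qed

lemma monic_chnI:
  assumes f: "f \<in> hom (chn C) M N" and m: "\<And>i. monic C (cmp f i)"
  shows "monic (chn C) f"
proof -
  interpret Ch: category "chn C" by (rule category_chn)
  show ?thesis
  proof (rule Ch.monicI[OF f])
    fix D u v assume *: "u \<in> hom (chn C) D M" "v \<in> hom (chn C) D M" "f \<cdot>\<^bsub>chn C\<^esub> u = f \<cdot>\<^bsub>chn C\<^esub> v"
    then have "cmp f i \<cdot> cmp u i = cmp f i \<cdot> cmp v i" for i by (metis cmp_Comp)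
    then show "u = v"
      using chn_hom_eqI[OF *(1,2)] monicD[OF m chn_homD(3)[OF f] chn_homD(3)[OF *(1)] chn_homD(3)[OF *(2)]] by blast
  qed
qed

lemma epic_chnI:
  assumes f: "f \<in> hom (chn C) M N" and m: "\<And>i. epic C (cmp f i)"
  shows "epic (chn C) f"
proof -
  interpret Ch: category "chn C" by (rule category_chn)
  show ?thesis
  proof (rule Ch.epicI[OF f])
    fix D u v assume *: "u \<in> hom (chn C) N D" "v \<in> hom (chn C) N D" "u \<cdot>\<^bsub>chn C\<^esub> f = v \<cdot>\<^bsub>chn C\<^esub> f"
    then have "cmp u i \<cdot> cmp f i = cmp v i \<cdot> cmp f i" for i by (metis cmp_Comp)
    then show "u = v"
      using chn_hom_eqI[OF *(1,2)] epicD[OF m chn_homD(3)[OF f] chn_homD(3)[OF *(1)] chn_homD(3)[OF *(2)]] by blast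
  qed
qed

lemma disc_simps [simp]:
  "ob (disc C i D) j = (if j = i \<or> j = i - 1 then D else Zero C)"
  "bd (disc C i D) j = (if j = i then Idn C D
     else zero_map C (ob (disc C i D) j) (ob (disc C i D) (j - 1)))"
  by (simp_all add: disc_def Let_def)

lemma chain_complex_disc:
  assumes "D \<in> Obj C"
  shows "chain_complex C (disc C i D)"
proof (rule chain_complexI)
  have Z: "Zero C \<in> Obj C" using Zero_zero zero_obj_Obj by blast
  have O: "ob (disc C i D) j \<in> Obj C" for j using assms Z by simp
  show h: "bd (disc C i D) j \<in> hom C (ob (disc C i D) j) (ob (disc C i D) (j - 1))" for j
    using Idn_hom[OF assms] zero_map_hom[OF O O, of j "j - 1"] by (cases "j = i") auto
  fix j
  show "bd (disc C i D) j \<cdot> bd (disc C i D) (j + 1) =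
      zero_map C (ob (disc C i D) (j + 1)) (ob (disc C i D) (j - 1))"
  proof (cases "j = i")
    case True
    then have 0: "bd (disc C i D) (j + 1) = zero_map C (ob (disc C i D) (j + 1)) (ob (disc C i D) j)"
      by simp
    show ?thesis unfolding 0 by (rule comp_zero[OF O h])
  next
    case False
    then have 0: "bd (disc C i D) j = zero_map C (ob (disc C i D) j) (ob (disc C i D) (j - 1))" by simp
    have "bd (disc C i D) (j + 1) \<in> hom C (ob (disc C i D) (j + 1)) (ob (disc C i D) j)"
      using h[of "j + 1"] by (simp del: disc_simps)
    then show ?thesis unfolding 0 by (rule zero_comp[OF O])
  qed
qed

lemma disc_map_hom:
  assumes M: "chain_complex C M" and u: "u \<in> hom C D (ob M i)"
  shows "disc_map C i D M u \<in> hom (chn C) (disc C i D) M"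
proof -
  let ?a = "\<lambda>j. if j = i then u else if j = i - 1 then bd M i \<cdot> u else zero_map C (Zero C) (ob M j)"
  note d = chain_complexD(2)[OF M] and MO = chain_complexD(1)[OF M]
  have Z: "Zero C \<in> Obj C" using Zero_zero zero_obj_Obj by blast
  have D: "D \<in> Obj C" using u hom_Obj by blast
  have bu: "bd M i \<cdot> u \<in> hom C D (ob M (i - 1))" using Comp_hom[OF u d] .
  have "ChainMap (disc C i D) ?a M \<in> hom (chn C) (disc C i D) M"
  proof (rule chn_homI[OF chain_complex_disc[OF D] M])
    show a: "?a j \<in> hom C (ob (disc C i D) j) (ob M j)" for j
      using u bu zero_map_hom[OF Z MO] by simp
    fix j
    show "?a (j - 1) \<cdot> bd (disc C i D) j = bd M j \<cdot> ?a j"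
    proof (cases "j = i")
      case True
      then show ?thesis using Comp_Idn[OF bu] by simp
    next
      case False
      have "bd M j \<cdot> ?a j = zero_map C (ob (disc C i D) j) (ob M (j - 1))"
      proof (cases "j = i - 1")
        case True
        have "bd M (i - 1) \<cdot> (bd M i \<cdot> u) = (bd M (i - 1) \<cdot> bd M i) \<cdot> u"
          using Comp_assoc[OF u d d] by simp
        also have "\<dots> = zero_map C D (ob M (i - 1 - 1))"
          using bd_bd[OF M, of "i - 1"] zero_comp[OF MO u] by simp
        finally show ?thesis using True by simp
      next
        case F: False
        then show ?thesis using comp_zero[OF Z d] False by simp
      qed
      moreover have "?a (j - 1) \<cdot> bd (disc C i D) j = zero_map C (ob (disc C i D) j) (ob M (j - 1))"
      proof -
        have "bd (disc C i D) j = zero_map C (ob (disc C i D) j) (ob (disc C i D) (j - 1))"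
          using False by simp
        moreover have "ob (disc C i D) j \<in> Obj C" using D Z by simp
        ultimately show ?thesis using comp_zero[OF _ a[of "j - 1"]] by (simp del: disc_simps)
      qed
      ultimately show ?thesis by simp
    qed
  qed
  then show ?thesis by (simp add: disc_map_def)
qed

text \<open>Two arrows identified by \<open>f\<close> in degree \<open>i\<close> give chain maps out of the disc identified by \<open>f\<close>: the components in
  degree \<open>i - 1\<close> agree after composing with \<open>f\<close> because \<open>f\<close> commutes with the differentials.\<close>

lemma monic_chn_cmp:
  assumes m: "monic (chn C) f" and f: "f \<in> hom (chn C) M N"
  shows "monic C (cmp f i)"
proof (rule monicI[OF chn_homD(3)[OF f]])
  interpret Ch: category "chn C" by (rule category_chn)
  note M = chn_homD(1)[OF f]
  note d = chain_complexD(2)[OF M]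
  fix D u v assume *: "u \<in> hom C D (ob M i)" "v \<in> hom C D (ob M i)" "cmp f i \<cdot> u = cmp f i \<cdot> v"
  note U = disc_map_hom[OF M *(1)] and V = disc_map_hom[OF M *(2)]
  have "cmp f (i - 1) \<cdot> (bd M i \<cdot> u) = cmp f (i - 1) \<cdot> (bd M i \<cdot> v)"
    using Comp_assoc[OF *(1) d chn_homD(3)[OF f]] Comp_assoc[OF *(2) d chn_homD(3)[OF f]]
      Comp_assoc[OF *(1) chn_homD(3)[OF f] chain_complexD(2)[OF chn_homD(2)[OF f]]]
      Comp_assoc[OF *(2) chn_homD(3)[OF f] chain_complexD(2)[OF chn_homD(2)[OF f]]]
      chn_homD(4)[OF f] *(3) by simp
  then have "f \<cdot>\<^bsub>chn C\<^esub> disc_map C i D M u = f \<cdot>\<^bsub>chn C\<^esub> disc_map C i D M v"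
    by (intro chn_hom_eqI[OF Ch.Comp_hom[OF U f] Ch.Comp_hom[OF V f]]) (simp add: disc_map_def *(3))
  then have "disc_map C i D M u = disc_map C i D M v" using Ch.monicD[OF m f U V] by blast
  then have "cmp (disc_map C i D M u) i = cmp (disc_map C i D M v) i" by simp
  then show "u = v" by (simp add: disc_map_def)
qed

section \<open>Short exact sequences of complexes\<close>

lemma short_exact_chn:
  assumes k: "k \<in> hom (chn C) A M" and p: "p \<in> hom (chn C) M B"
    and se: "\<And>i. short_exact C (cmp k i) (cmp p i)"
  shows "short_exact (chn C) k p"
proof -
  interpret Ch: pointed_category "chn C" by (rule pointed_chn)
  note k' = chn_homD[OF k] and p' = chn_homD[OF p]
  have ker: "is_kernel C (cmp p i) (cmp k i)" and cok: "is_cokernel C (cmp k i) (cmp p i)" for i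
    using se short_exact_def by metis+
  note K = is_kernelD[OF ker p'(3), unfolded homD[OF k'(3)]]
    and Q = is_cokernelD[OF cok k'(3), unfolded homD[OF p'(3)]]
  have z: "p \<cdot>\<^bsub>chn C\<^esub> k = zero_map (chn C) A B"
    using chn_eq_zero_iff[OF Ch.Comp_hom[OF k p]] K(2) by simp
  have "is_kernel (chn C) p k"
  proof (rule Ch.is_kernelI[OF p k z monic_chnI[OF k K(3)]])
    fix E h assume h: "h \<in> hom (chn C) E M" "p \<cdot>\<^bsub>chn C\<^esub> h = zero_map (chn C) E B"
    note h' = chn_homD[OF h(1)]
    have "cmp p i \<cdot> cmp h i = zero_map C (ob E i) (ob B i)" for i
      using h(2) chn_eq_zero_iff[OF Ch.Comp_hom[OF h(1) p]] by simp
    then have "\<exists>u. u \<in> hom C (ob E i) (ob A i) \<and> cmp k i \<cdot> u = cmp h i" for i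
      using K(4)[OF h'(3)] by blast
    then obtain u where u: "\<And>i. u i \<in> hom C (ob E i) (ob A i)" "\<And>i. cmp k i \<cdot> u i = cmp h i"
      by metis
    have U: "ChainMap E u A \<in> hom (chn C) E A"
    proof (rule chn_homI[OF h'(1) k'(1) u(1)])
      fix i
      note dE = chain_complexD(2)[OF h'(1)] and dA = chain_complexD(2)[OF k'(1)]
        and dM = chain_complexD(2)[OF k'(2)]
      have "cmp k (i - 1) \<cdot> (u (i - 1) \<cdot> bd E i) = cmp h (i - 1) \<cdot> bd E i"
        using Comp_assoc[OF dE u(1) k'(3)] u(2) by simp
      also have "\<dots> = bd M i \<cdot> (cmp k i \<cdot> u i)" using h'(4) u(2) by simp
      also have "\<dots> = cmp k (i - 1) \<cdot> (bd A i \<cdot> u i)"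
        using Comp_assoc[OF u(1) k'(3) dM] Comp_assoc[OF u(1) dA k'(3)] k'(4) by simp
      finally show "u (i - 1) \<cdot> bd E i = bd A i \<cdot> u i"
        using monicD[OF K(3) k'(3) Comp_hom[OF dE u(1)] Comp_hom[OF u(1) dA]] by blast
    qed
    have "k \<cdot>\<^bsub>chn C\<^esub> ChainMap E u A = h"
      using chn_hom_eqI[OF Ch.Comp_hom[OF U k] h(1)] u(2) by simp
    then show "\<exists>u \<in> hom (chn C) E A. k \<cdot>\<^bsub>chn C\<^esub> u = h" using U by blast
  qed
  moreover have "is_cokernel (chn C) k p"
  proof (rule Ch.is_cokernelI[OF k p z epic_chnI[OF p Q(3)]])
    fix E h assume h: "h \<in> hom (chn C) M E" "h \<cdot>\<^bsub>chn C\<^esub> k = zero_map (chn C) A E"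
    note h' = chn_homD[OF h(1)]
    have "cmp h i \<cdot> cmp k i = zero_map C (ob A i) (ob E i)" for i
      using h(2) chn_eq_zero_iff[OF Ch.Comp_hom[OF k h(1)]] by simp
    then have "\<exists>u. u \<in> hom C (ob B i) (ob E i) \<and> u \<cdot> cmp p i = cmp h i" for i
      using Q(4)[OF h'(3)] by blast
    then obtain u where u: "\<And>i. u i \<in> hom C (ob B i) (ob E i)" "\<And>i. u i \<cdot> cmp p i = cmp h i"
      by metis
    have U: "ChainMap B u E \<in> hom (chn C) B E"
    proof (rule chn_homI[OF p'(2) h'(2) u(1)])
      fix i
      note dE = chain_complexD(2)[OF h'(2)] and dB = chain_complexD(2)[OF p'(2)]
        and dM = chain_complexD(2)[OF p'(1)]
      have "(u (i - 1) \<cdot> bd B i) \<cdot> cmp p i = u (i - 1) \<cdot> (cmp p (i - 1) \<cdot> bd M i)"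
        using Comp_assoc[OF p'(3) dB u(1)] p'(4) by simp
      also have "\<dots> = bd E i \<cdot> cmp h i"
        using Comp_assoc[OF dM p'(3) u(1)] u(2) h'(4) by simp
      also have "\<dots> = (bd E i \<cdot> u i) \<cdot> cmp p i"
        using Comp_assoc[OF p'(3) u(1) dE] u(2) by simp
      finally show "u (i - 1) \<cdot> bd B i = bd E i \<cdot> u i"
        using epicD[OF Q(3) p'(3) Comp_hom[OF dB u(1)] Comp_hom[OF u(1) dE]] by blast
    qed
    have "ChainMap B u E \<cdot>\<^bsub>chn C\<^esub> p = h"
      using chn_hom_eqI[OF Ch.Comp_hom[OF p U] h(1)] u(2) by simp
    then show "\<exists>u \<in> hom (chn C) B E. u \<cdot>\<^bsub>chn C\<^esub> p = h" using U by blast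
  qed
  ultimately show ?thesis by (simp add: short_exact_def)
qed

text \<open>The last hypothesis says that the subobjects are stable under the differential of \<open>M\<close>; the differentials
  of the subcomplex and of the quotient are then induced, and their squares vanish because every \<open>k i\<close> is
  monic and every \<open>p i\<close> is epic.\<close>

lemma ex_short_exact_chn:
  assumes M: "chain_complex C M" and se: "\<And>i. short_exact C (k i) (p i)"
    and k: "\<And>i. k i \<in> hom C (A i) (ob M i)" and p: "\<And>i. p i \<in> hom C (ob M i) (B i)"
    and sub: "\<And>i. p (i - 1) \<cdot> (bd M i \<cdot> k i) = zero_map C (A i) (B (i - 1))"
  shows "\<exists>a b. ChainMap (Chain A a) k M \<in> hom (chn C) (Chain A a) M \<and>
    ChainMap M p (Chain B b) \<in> hom (chn C) M (Chain B b) \<and>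
    short_exact (chn C) (ChainMap (Chain A a) k M) (ChainMap M p (Chain B b))"
proof -
  have ker: "is_kernel C (p i) (k i)" and cok: "is_cokernel C (k i) (p i)" for i
    using se short_exact_def by metis+
  note K = is_kernelD[OF ker p, unfolded homD[OF k]]
    and Q = is_cokernelD[OF cok k, unfolded homD[OF p]]
  note d = chain_complexD(2)[OF M] and d1 = chain_complexD(3)[OF M]
  have AO: "A i \<in> Obj C" and BO: "B i \<in> Obj C" for i using k p hom_Obj by blast+
  have "\<exists>u. u \<in> hom C (A i) (A (i - 1)) \<and> k (i - 1) \<cdot> u = bd M i \<cdot> k i" for i
    using K(4)[OF Comp_hom[OF k d] sub] by blast
  then obtain a where a: "\<And>i. a i \<in> hom C (A i) (A (i - 1))" "\<And>i. k (i - 1) \<cdot> a i = bd M i \<cdot> k i"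
    by metis
  have "(p (i - 1) \<cdot> bd M i) \<cdot> k i = zero_map C (A i) (B (i - 1))" for i
    using Comp_assoc[OF k d p] sub by simp
  then have "\<exists>u. u \<in> hom C (B i) (B (i - 1)) \<and> u \<cdot> p i = p (i - 1) \<cdot> bd M i" for i
    using Q(4)[OF Comp_hom[OF d p]] by blast
  then obtain b where b: "\<And>i. b i \<in> hom C (B i) (B (i - 1))" "\<And>i. b i \<cdot> p i = p (i - 1) \<cdot> bd M i"
    by metis
  have a1: "a (i + 1) \<in> hom C (A (i + 1)) (A i)" "k i \<cdot> a (i + 1) = bd M (i + 1) \<cdot> k (i + 1)" for i
    using a[of "i + 1"] by simp_all
  have b1: "b (i + 1) \<in> hom C (B (i + 1)) (B i)" "b (i + 1) \<cdot> p (i + 1) = p i \<cdot> bd M (i + 1)" for i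
    using b[of "i + 1"] by simp_all
  have cA: "chain_complex C (Chain A a)"
  proof (rule chain_complexI)
    show "bd (Chain A a) i \<in> hom C (ob (Chain A a) i) (ob (Chain A a) (i - 1))" for i using a by simp
    fix i
    have "k (i - 1) \<cdot> (a i \<cdot> a (i + 1)) = bd M i \<cdot> (k i \<cdot> a (i + 1))"
      using Comp_assoc[OF a1(1) a(1) k] Comp_assoc[OF a1(1) k d] a(2) by simp
    also have "\<dots> = zero_map C (A (i + 1)) (ob M (i - 1))"
      using Comp_assoc[OF k d1 d] a1(2) bd_bd[OF M] zero_comp[OF chain_complexD(1)[OF M] k] by simp
    finally have "a i \<cdot> a (i + 1) = zero_map C (A (i + 1)) (A (i - 1))"
      using zero_cancel_monic[OF K(3) k Comp_hom[OF a1(1) a(1)]] by blast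
    then show "bd (Chain A a) i \<cdot> bd (Chain A a) (i + 1) =
        zero_map C (ob (Chain A a) (i + 1)) (ob (Chain A a) (i - 1))" by simp
  qed
  have cB: "chain_complex C (Chain B b)"
  proof (rule chain_complexI)
    show "bd (Chain B b) i \<in> hom C (ob (Chain B b) i) (ob (Chain B b) (i - 1))" for i using b by simp
    fix i
    have "(b i \<cdot> b (i + 1)) \<cdot> p (i + 1) = (b i \<cdot> p i) \<cdot> bd M (i + 1)"
      using Comp_assoc[OF p b1(1) b(1)] Comp_assoc[OF d1 p b(1)] b1(2) by simp
    also have "\<dots> = zero_map C (ob M (i + 1)) (B (i - 1))"
      using Comp_assoc[OF d1 d p] b(2) bd_bd[OF M] comp_zero[OF chain_complexD(1)[OF M] p] by simp
    finally have "b i \<cdot> b (i + 1) = zero_map C (B (i + 1)) (B (i - 1))"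
      using zero_cancel_epic[OF Q(3) p Comp_hom[OF b1(1) b(1)]] by blast
    then show "bd (Chain B b) i \<cdot> bd (Chain B b) (i + 1) =
        zero_map C (ob (Chain B b) (i + 1)) (ob (Chain B b) (i - 1))" by simp
  qed
  have "ChainMap (Chain A a) k M \<in> hom (chn C) (Chain A a) M"
    using chn_homI[OF cA M, of k] k a(2) by simp
  moreover have "ChainMap M p (Chain B b) \<in> hom (chn C) M (Chain B b)"
    using chn_homI[OF M cB, of p] p b(2) by simp
  ultimately show ?thesis using short_exact_chn se by (metis chain_map.sel(2))
qed

end

section \<open>Truncation sequences\<close>

context pointed_category
begin

text \<open>A differential of \<open>A\<close> that starts where the inclusion is the identity becomes one of \<open>M\<close> after composition
  with a monomorphism. Truncations satisfy the last hypothesis.\<close>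

lemma proper_subcomplex:
  assumes k: "k \<in> hom (chn C) A M" and "\<And>i. monic C (cmp k i)" and M: "proper_chain C M"
    and c: "\<And>i. cmp k i = Idn C (ob M i) \<or> zero_obj C (ob A i) \<or> zero_obj C (ob A (i - 1))"
  shows "proper_chain C A"
  unfolding proper_chain_iff
proof (intro conjI allI)
  note k' = chn_homD[OF k]
  show "chain_complex C A" by (rule k')
  fix i
  note d = chain_complexD(2)[OF k'(1), of i]
  show "proper_arrow C (bd A i)"
  proof (cases "zero_obj C (ob A i) \<or> zero_obj C (ob A (i - 1))")
    case True
    then show ?thesis using proper_arrow_zero[OF d] by blast
  next
    case False
    then have "cmp k i = Idn C (ob M i)" using c by blast
    then have "cmp k (i - 1) \<cdot> bd A i = bd M i"
      using k'(4) Comp_Idn[OF chain_complexD(2)[OF k'(2)]] by simp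
    then show ?thesis
      using proper_arrow_corestrict[OF _ d k'(3)] assms(2) M unfolding proper_chain_iff by simp
  qed
qed

lemma proper_quotient_complex:
  assumes p: "p \<in> hom (chn C) M B" and "\<And>i. normal_epi C (cmp p i)" and M: "proper_chain C M"
    and c: "\<And>i. cmp p (i - 1) = Idn C (ob M (i - 1)) \<or> zero_obj C (ob B i) \<or> zero_obj C (ob B (i - 1))"
  shows "proper_chain C B"
  unfolding proper_chain_iff
proof (intro conjI allI)
  note p' = chn_homD[OF p]
  show "chain_complex C B" by (rule p')
  fix i
  note d = chain_complexD(2)[OF p'(2), of i]
  show "proper_arrow C (bd B i)"
  proof (cases "zero_obj C (ob B i) \<or> zero_obj C (ob B (i - 1))")
    case True
    then show ?thesis using proper_arrow_zero[OF d] by blast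
  next
    case False
    then have "cmp p (i - 1) = Idn C (ob M (i - 1))" using c by blast
    then have "bd B i \<cdot> cmp p i = bd M i"
      using p'(4)[of i] Idn_Comp[OF chain_complexD(2)[OF p'(1)]] by simp
    then show ?thesis
      using proper_arrow_factor_epi[OF _ d p'(3)] assms(2) M unfolding proper_chain_iff by simp
  qed
qed

lemma proper_sub_and_quotient:
  assumes k: "k \<in> hom (chn C) A M" and p: "p \<in> hom (chn C) M B"
    and se: "\<And>i. short_exact C (cmp k i) (cmp p i)" and M: "proper_chain C M"
    and "\<And>i. cmp k i = Idn C (ob M i) \<or> zero_obj C (ob A i) \<or> zero_obj C (ob A (i - 1))"
    and "\<And>i. cmp p (i - 1) = Idn C (ob M (i - 1)) \<or> zero_obj C (ob B i) \<or> zero_obj C (ob B (i - 1))"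
  shows "proper_chain C A \<and> proper_chain C B"
proof -
  have "monic C (cmp k i)" for i using is_kernelD(3)[OF _ chn_homD(3)[OF p]] se short_exact_def by metis
  moreover have "normal_epi C (cmp p i)" for i using short_exact_normal[OF se] by blast
  ultimately show ?thesis
    using proper_subcomplex[OF k _ M assms(5)] proper_quotient_complex[OF p _ M assms(6)] by blast
qed

lemma ex_brutal_truncation:
  assumes M: "chain_complex C M"
  shows "\<exists>A B k p. k \<in> hom (chn C) A M \<and> p \<in> hom (chn C) M B \<and> short_exact (chn C) k p \<and>
    (\<forall>i\<ge>j. zero_obj C (ob A i)) \<and> (\<forall>i<j. zero_obj C (ob B i)) \<and>
    (proper_chain C M \<longrightarrow> proper_chain C A \<and> proper_chain C B)"
proof -
  define A where "A i = (if i < j then ob M i else Zero C)" for i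
  define B where "B i = (if i < j then Zero C else ob M i)" for i
  define k where "k i = (if i < j then Idn C (ob M i) else zero_map C (Zero C) (ob M i))" for i
  define p where "p i = (if i < j then zero_map C (ob M i) (Zero C) else Idn C (ob M i))" for i
  note Z = Zero_zero
  note ZO = zero_obj_Obj[OF Z] and MO = chain_complexD(1)[OF M] and d = chain_complexD(2)[OF M]
  have k: "k i \<in> hom C (A i) (ob M i)" and p: "p i \<in> hom C (ob M i) (B i)" for i
    using Idn_hom[OF MO] zero_map_hom[OF ZO MO] zero_map_hom[OF MO ZO]
    by (simp_all add: A_def B_def k_def p_def)
  have AO: "A i \<in> Obj C" and BO: "B i \<in> Obj C" for i using k p hom_Obj by blast+
  have se: "short_exact C (k i) (p i)" for i
    using short_exact_zero_Idn[OF MO Z] short_exact_Idn_zero[OF MO Z] by (simp add: k_def p_def)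
  have sub: "p (i - 1) \<cdot> (bd M i \<cdot> k i) = zero_map C (A i) (B (i - 1))" for i
  proof (cases "i < j")
    case True
    then have "p (i - 1) = zero_map C (ob M (i - 1)) (B (i - 1))" by (simp add: p_def B_def)
    then show ?thesis using zero_comp[OF BO Comp_hom[OF k d]] by simp
  next
    case False
    then have "k i = zero_map C (A i) (ob M i)" by (simp add: k_def A_def)
    then show ?thesis using comp_zero[OF AO d] comp_zero[OF AO p] by simp
  qed
  obtain a b where *: "ChainMap (Chain A a) k M \<in> hom (chn C) (Chain A a) M"
    "ChainMap M p (Chain B b) \<in> hom (chn C) M (Chain B b)"
    "short_exact (chn C) (ChainMap (Chain A a) k M) (ChainMap M p (Chain B b))"
    using ex_short_exact_chn[OF M se k p sub] by blast
  have "proper_chain C (Chain A a) \<and> proper_chain C (Chain B b)" if "proper_chain C M"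
    using Z se by (intro proper_sub_and_quotient[OF *(1,2) _ that])
      (auto simp: k_def p_def A_def B_def)
  then show ?thesis using * Z
    by (intro exI[of _ "Chain A a"] exI[of _ "Chain B b"] exI conjI) (auto simp: A_def B_def)
qed

text \<open>Below \<open>j\<close> everything goes to the quotient, above \<open>j\<close> everything goes to the subcomplex, and \<open>M\<^sub>j\<close> is divided by
  the given sequence. The two hypotheses on differentials make the upper part a subcomplex.\<close>

lemma ex_good_truncation:
  assumes M: "chain_complex C M" and se0: "short_exact C k0 p0"
    and k0: "k0 \<in> hom C K (ob M j)" and p0: "p0 \<in> hom C (ob M j) Q"
    and dk: "bd M j \<cdot> k0 = zero_map C K (ob M (j - 1))"
    and pd: "p0 \<cdot> bd M (j + 1) = zero_map C (ob M (j + 1)) Q"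
  shows "\<exists>A B k p. k \<in> hom (chn C) A M \<and> p \<in> hom (chn C) M B \<and> short_exact (chn C) k p \<and>
    (\<forall>i<j. zero_obj C (ob A i)) \<and> (\<forall>i>j. zero_obj C (ob B i)) \<and>
    cmp k j = k0 \<and> cmp k (j + 1) = Idn C (ob M (j + 1)) \<and>
    cmp p j = p0 \<and> cmp p (j - 1) = Idn C (ob M (j - 1)) \<and>
    (proper_chain C M \<longrightarrow> proper_chain C A \<and> proper_chain C B)"
proof -
  define A where "A i = (if i < j then Zero C else if i = j then K else ob M i)" for i
  define B where "B i = (if i < j then ob M i else if i = j then Q else Zero C)" for i
  define k where "k i = (if i < j then zero_map C (Zero C) (ob M i)
    else if i = j then k0 else Idn C (ob M i))" for i
  define p where "p i = (if i < j then Idn C (ob M i)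
    else if i = j then p0 else zero_map C (ob M i) (Zero C))" for i
  note Z = Zero_zero
  note ZO = zero_obj_Obj[OF Z] and MO = chain_complexD(1)[OF M] and d = chain_complexD(2)[OF M]
  have k: "k i \<in> hom C (A i) (ob M i)" and p: "p i \<in> hom C (ob M i) (B i)" for i
    using Idn_hom[OF MO] zero_map_hom[OF ZO MO] zero_map_hom[OF MO ZO] k0 p0
    by (simp_all add: A_def B_def k_def p_def)
  have AO: "A i \<in> Obj C" and BO: "B i \<in> Obj C" for i using k p hom_Obj by blast+
  have se: "short_exact C (k i) (p i)" for i
    using short_exact_zero_Idn[OF MO Z] short_exact_Idn_zero[OF MO Z] se0 by (simp add: k_def p_def)
  have sub: "p (i - 1) \<cdot> (bd M i \<cdot> k i) = zero_map C (A i) (B (i - 1))" for i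
  proof -
    consider "i < j" | "i = j" | "i = j + 1" | "i > j + 1" by linarith
    then show ?thesis
    proof cases
      case 1
      then have "k i = zero_map C (A i) (ob M i)" by (simp add: k_def A_def)
      then show ?thesis using comp_zero[OF AO d] comp_zero[OF AO p] by simp
    next
      case 2
      then have "bd M i \<cdot> k i = zero_map C (A i) (ob M (i - 1))" using dk by (simp add: k_def A_def)
      then show ?thesis using comp_zero[OF AO p] by simp
    next
      case 3
      then have "bd M i \<cdot> k i = bd M i" using Comp_Idn[OF d] by (simp add: k_def)
      then show ?thesis using pd 3 by (simp add: p_def A_def B_def)
    next
      case 4
      then have "p (i - 1) = zero_map C (ob M (i - 1)) (B (i - 1))" by (simp add: p_def B_def)
      then show ?thesis using zero_comp[OF BO Comp_hom[OF k d]] by simp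
    qed
  qed
  obtain a b where *: "ChainMap (Chain A a) k M \<in> hom (chn C) (Chain A a) M"
    "ChainMap M p (Chain B b) \<in> hom (chn C) M (Chain B b)"
    "short_exact (chn C) (ChainMap (Chain A a) k M) (ChainMap M p (Chain B b))"
    using ex_short_exact_chn[OF M se k p sub] by blast
  have "proper_chain C (Chain A a) \<and> proper_chain C (Chain B b)" if "proper_chain C M"
    using Z se by (intro proper_sub_and_quotient[OF *(1,2) _ that])
      (auto simp: k_def p_def A_def B_def)
  then show ?thesis using * Z
    by (intro exI[of _ "Chain A a"] exI[of _ "Chain B b"] exI[of _ "ChainMap (Chain A a) k M"]
        exI[of _ "ChainMap M p (Chain B b)"] conjI) (auto simp: A_def B_def k_def p_def)
qed

end

section \<open>The torsion theories\<close>

lemma pch_Obj: "Obj (pch C) = {M. proper_chain C M}"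
  by (auto simp: pch_def proper_chain_iff)

definition monic_top :: "('o, 'm) cat \<Rightarrow> int \<Rightarrow> ('o, 'm) chain set" where
  "monic_top C n = {M. chain_complex C M \<and> (\<forall>i>n. zero_obj C (ob M i)) \<and> monic C (bd M n)}"

definition epic_bottom :: "('o, 'm) cat \<Rightarrow> int \<Rightarrow> ('o, 'm) chain set" where
  "epic_bottom C n = {M. chain_complex C M \<and> (\<forall>i<n - 1. zero_obj C (ob M i)) \<and> epic C (bd M n)}"

context pointed_category
begin

lemma iso_monic: "iso C f \<Longrightarrow> monic C f" and iso_epic: "iso C f \<Longrightarrow> epic C f"
proof -
  assume i: "iso C f"
  then have f: "f \<in> hom C (Dom C f) (Cod C f)" unfolding iso_def by (simp add: homI)
  obtain g where g: "g \<in> hom C (Cod C f) (Dom C f)" "g \<cdot> f = Idn C (Dom C f)" "f \<cdot> g = Idn C (Cod C f)"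
    using isoE[OF i f] by blast
  show "monic C f" using section_monic[OF f g(1,2)] .
  show "epic C f" using retraction_epic[OF f g(1,3)] .
qed

lemma replete_chnI:
  assumes "\<And>f M N. \<lbrakk>f \<in> hom (chn C) M N; \<And>i. iso C (cmp f i); M \<in> S\<rbrakk> \<Longrightarrow> N \<in> S"
  shows "replete (chn C) S"
  unfolding replete_def
proof (intro allI impI)
  fix f assume f: "iso (chn C) f \<and> Dom (chn C) f \<in> S"
  then have h: "f \<in> hom (chn C) (src f) (tgt f)" unfolding iso_def hom_def by simp
  then show "Cod (chn C) f \<in> S" using assms[OF h] iso_chn_cmp f by simp
qed

lemma replete_chn_le: "replete (chn C) (chn_le C n)"
proof (rule replete_chnI)
  fix f M N assume "f \<in> hom (chn C) M N" "\<And>i. iso C (cmp f i)" "M \<in> chn_le C n"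
  then show "N \<in> chn_le C n"
    using chn_homD(2,3)[of f C M N] zero_obj_iso unfolding chn_le_def by simp blast
qed

lemma replete_chn_ge: "replete (chn C) (chn_ge C n)"
proof (rule replete_chnI)
  fix f M N assume "f \<in> hom (chn C) M N" "\<And>i. iso C (cmp f i)" "M \<in> chn_ge C n"
  then show "N \<in> chn_ge C n"
    using chn_homD(2,3)[of f C M N] zero_obj_iso unfolding chn_ge_def by simp blast
qed

lemma replete_monic_top: "replete (chn C) (monic_top C n)"
proof (rule replete_chnI)
  fix f M N assume f: "f \<in> hom (chn C) M N" and i: "\<And>i. iso C (cmp f i)" and M: "M \<in> monic_top C n"
  note f' = chn_homD[OF f]
  note dM = chain_complexD(2)[OF f'(1)] and dN = chain_complexD(2)[OF f'(2)]
  obtain g where g: "g \<in> hom C (ob N n) (ob M n)" "cmp f n \<cdot> g = Idn C (ob N n)" "g \<cdot> cmp f n = Idn C (ob M n)"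
    using isoE[OF i f'(3)] by blast
  have gm: "monic C g" using section_monic[OF g(1) f'(3) g(2)] .
  have "bd N n = bd N n \<cdot> (cmp f n \<cdot> g)" using g(2) Comp_Idn[OF dN] by simp
  also have "\<dots> = (cmp f (n - 1) \<cdot> bd M n) \<cdot> g" using Comp_assoc[OF g(1) f'(3) dN] f'(4) by simp
  finally have "monic C (bd N n)"
    using monic_comp[OF monic_comp[OF iso_monic[OF i] _ dM f'(3)] gm g(1) Comp_hom[OF dM f'(3)]] M
    unfolding monic_top_def by simp
  then show "N \<in> monic_top C n"
    using M f'(2) zero_obj_iso[OF i f'(3)] unfolding monic_top_def by simp
qed

lemma replete_epic_bottom: "replete (chn C) (epic_bottom C n)"
proof (rule replete_chnI)
  fix f M N assume f: "f \<in> hom (chn C) M N" and i: "\<And>i. iso C (cmp f i)" and M: "M \<in> epic_bottom C n"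
  note f' = chn_homD[OF f]
  note dM = chain_complexD(2)[OF f'(1)] and dN = chain_complexD(2)[OF f'(2)]
  obtain g where g: "g \<in> hom C (ob N n) (ob M n)" "cmp f n \<cdot> g = Idn C (ob N n)" "g \<cdot> cmp f n = Idn C (ob M n)"
    using isoE[OF i f'(3)] by blast
  have ge: "epic C g" using retraction_epic[OF g(1) f'(3) g(3)] .
  have "bd N n = bd N n \<cdot> (cmp f n \<cdot> g)" using g(2) Comp_Idn[OF dN] by simp
  also have "\<dots> = (cmp f (n - 1) \<cdot> bd M n) \<cdot> g" using Comp_assoc[OF g(1) f'(3) dN] f'(4) by simp
  finally have "epic C (bd N n)"
    using epic_comp[OF epic_comp[OF iso_epic[OF i] _ dM f'(3)] ge g(1) Comp_hom[OF dM f'(3)]] M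
    unfolding epic_bottom_def by simp
  then show "N \<in> epic_bottom C n"
    using M f'(2) zero_obj_iso[OF i f'(3)] unfolding epic_bottom_def by simp
qed

lemma chn_eq_zeroI:
  assumes f: "f \<in> hom (chn C) M N"
    and c: "\<And>i. zero_obj C (ob M i) \<or> zero_obj C (ob N i) \<or> cmp f i = zero_map C (ob M i) (ob N i)"
  shows "f = zero_map (chn C) M N"
  using chn_eq_zero_iff[OF f] hom_zero_obj[OF chn_homD(3)[OF f]] c by blast

lemma torsion_le_ge:
  assumes D: "D = UNIV \<or> D = {M. proper_chain C M}"
  shows "torsion_theory (full_subcat (chn C) D) (chn_le C (n - 1) \<inter> D) (chn_ge C n \<inter> D)"
proof -
  interpret Ch: pointed_category "chn C" by (rule pointed_chn)
  have ZD: "zero_chain \<in> D" using D proper_zero_chain by auto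
  show ?thesis
  proof (rule Ch.torsion_theory_full_subcat[OF zero_chain(2) ZD _ _ replete_chn_le replete_chn_ge])
    show "chn_le C (n - 1) \<subseteq> Obj (chn C)" "chn_ge C n \<subseteq> Obj (chn C)"
      by (auto simp: chn_le_def chn_ge_def)
    fix A B f assume *: "A \<in> chn_le C (n - 1)" "B \<in> chn_ge C n" "f \<in> hom (chn C) A B"
    have "zero_obj C (ob A i) \<or> zero_obj C (ob B i)" for i
      using *(1,2) by (cases "i < n") (auto simp: chn_le_def chn_ge_def)
    then show "f = zero_map (chn C) A B" using chn_eq_zeroI[OF *(3)] by blast
  next
    fix M assume M: "M \<in> Obj (chn C)" "M \<in> D"
    obtain A B k p where *: "k \<in> hom (chn C) A M" "p \<in> hom (chn C) M B" "short_exact (chn C) k p"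
      "\<forall>i\<ge>n. zero_obj C (ob A i)" "\<forall>i<n. zero_obj C (ob B i)"
      "proper_chain C M \<longrightarrow> proper_chain C A \<and> proper_chain C B"
      using ex_brutal_truncation[of M n] M by auto
    have "A \<in> chn_le C (n - 1) \<inter> D" "B \<in> chn_ge C n \<inter> D"
      using * chn_homD(1)[OF *(1)] chn_homD(2)[OF *(2)] D M by (auto simp: chn_le_def chn_ge_def)
    then show "\<exists>A \<in> chn_le C (n - 1) \<inter> D. \<exists>B \<in> chn_ge C n \<inter> D.
        \<exists>k \<in> hom (chn C) A M. \<exists>p \<in> hom (chn C) M B. short_exact (chn C) k p"
      using *(1-3) by blast
  qed
qed

end

context semi_abelian
begin

text \<open>Good truncation at \<open>n\<close>, dividing \<open>M\<^sub>n\<close> into the kernel and the image of \<open>\<delta>\<^sub>n\<close>.\<close>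

lemma torsion_ge_monic_top:
  assumes D: "D = UNIV \<or> D = {M. proper_chain C M}"
  shows "torsion_theory (full_subcat (chn C) D) (chn_ge C n \<inter> D) (monic_top C n \<inter> D)"
proof -
  interpret Ch: pointed_category "chn C" by (rule pointed_chn)
  have ZD: "zero_chain \<in> D" using D proper_zero_chain by auto
  show ?thesis
  proof (rule Ch.torsion_theory_full_subcat[OF zero_chain(2) ZD _ _ replete_chn_ge replete_monic_top])
    show "chn_ge C n \<subseteq> Obj (chn C)" "monic_top C n \<subseteq> Obj (chn C)"
      by (auto simp: monic_top_def chn_ge_def)
    fix A B f assume *: "A \<in> chn_ge C n" "B \<in> monic_top C n" "f \<in> hom (chn C) A B"
    note f' = chn_homD[OF *(3)]
    note dA = chain_complexD(2)[OF f'(1)] and dB = chain_complexD(2)[OF f'(2)]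
    have "zero_obj C (ob A (n - 1))" using *(1) by (simp add: chn_ge_def)
    then have "cmp f (n - 1) \<cdot> bd A n = zero_map C (ob A n) (ob B (n - 1))"
      using hom_zero_obj[OF f'(3)[of "n - 1"]] zero_comp[OF chain_complexD(1)[OF f'(2)] dA] by simp
    then have "cmp f n = zero_map C (ob A n) (ob B n)"
      using zero_cancel_monic[OF _ dB f'(3)] f'(4)[of n] *(2) by (simp add: monic_top_def)
    moreover have "zero_obj C (ob A i) \<or> zero_obj C (ob B i) \<or> i = n" for i
      using *(1,2) by (cases "i < n") (auto simp: monic_top_def chn_ge_def)
    ultimately show "f = zero_map (chn C) A B" using chn_eq_zeroI[OF *(3)] by metis
  next
    fix M assume M: "M \<in> Obj (chn C)" "M \<in> D"
    then have MC: "chain_complex C M" by simp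
    note d = chain_complexD(2)[OF MC]
    obtain e m I where em: "e \<in> hom C (ob M n) I" "m \<in> hom C I (ob M (n - 1))" "bd M n = m \<cdot> e"
      "normal_epi C e" "monic C m"
      using ex_normal_epi_monic_factorization[OF d] by metis
    have ee: "epic C e" using normal_epi_epic em(4) .
    obtain k0 where k0: "is_kernel C e k0" using ex_kernel[OF em(1)] by blast
    note K = is_kernelD[OF k0 em(1)]
    have se: "short_exact C k0 e"
      using k0 normal_epi_cokernel_of_kernel[OF em(4) k0] by (simp add: short_exact_def)
    have dk: "bd M n \<cdot> k0 = zero_map C (Dom C k0) (ob M (n - 1))"
      using em(3) Comp_assoc[OF K(1) em(1,2)] K(2) comp_zero[OF _ em(2)] hom_Obj[OF K(1)] by simp
    have "m \<cdot> (e \<cdot> bd M (n + 1)) = zero_map C (ob M (n + 1)) (ob M (n - 1))"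
      using Comp_assoc[OF chain_complexD(3)[OF MC] em(1,2)] em(3) bd_bd[OF MC, of n] by simp
    then have pd: "e \<cdot> bd M (n + 1) = zero_map C (ob M (n + 1)) I"
      using zero_cancel_monic[OF em(5,2) Comp_hom[OF chain_complexD(3)[OF MC] em(1)]] by blast
    obtain A B k p where *: "k \<in> hom (chn C) A M" "p \<in> hom (chn C) M B" "short_exact (chn C) k p"
      "\<forall>i<n. zero_obj C (ob A i)" "\<forall>i>n. zero_obj C (ob B i)"
      "cmp p n = e" "cmp p (n - 1) = Idn C (ob M (n - 1))"
      "proper_chain C M \<longrightarrow> proper_chain C A \<and> proper_chain C B"
      using ex_good_truncation[OF MC se K(1) em(1) dk pd] by auto
    note p' = chn_homD[OF *(2)]
    have BI: "ob B n = I" using p'(3)[of n] *(6) homD[OF em(1)] by (simp add: hom_def)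
    have "ob B (n - 1) = ob M (n - 1)"
      using p'(3)[of "n - 1"] *(7) homD[OF Idn_hom[OF chain_complexD(1)[OF MC, of "n - 1"]]] by (simp add: hom_def)
    then have dB: "bd B n \<in> hom C I (ob M (n - 1))" using chain_complexD(2)[OF p'(2), of n] BI by simp
    have "bd B n \<cdot> e = m \<cdot> e" using p'(4)[of n] *(6,7) Idn_Comp[OF d[of n]] em(3) by simp
    then have "bd B n = m" using epicD[OF ee em(1) dB em(2)] by blast
    then have "A \<in> chn_ge C n \<inter> D" "B \<in> monic_top C n \<inter> D"
      using * chn_homD(1)[OF *(1)] p'(2) D M em(5) by (auto simp: monic_top_def chn_ge_def)
    then show "\<exists>A \<in> chn_ge C n \<inter> D. \<exists>B \<in> monic_top C n \<inter> D.
        \<exists>k \<in> hom (chn C) A M. \<exists>p \<in> hom (chn C) M B. short_exact (chn C) k p"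
      using *(1-3) by blast
  qed
qed

text \<open>Good truncation at \<open>n - 1\<close>, dividing \<open>M\<^bsub>n-1\<^esub>\<close> into the image and the cokernel of \<open>\<delta>\<^sub>n\<close>. Properness makes the
  inclusion of the image a kernel.\<close>

lemma torsion_epic_bottom_le:
  "torsion_theory (pch C) (epic_bottom C n \<inter> Obj (pch C)) (chn_le C (n - 1) \<inter> Obj (pch C))"
proof -
  interpret Ch: pointed_category "chn C" by (rule pointed_chn)
  define D where "D = {M. proper_chain C M}"
  have D: "D = {M. proper_chain C M}" by (rule D_def)
  have ZD: "zero_chain \<in> D" using D proper_zero_chain by auto
  have "torsion_theory (full_subcat (chn C) D) (epic_bottom C n \<inter> D) (chn_le C (n - 1) \<inter> D)"
  proof (rule Ch.torsion_theory_full_subcat[OF zero_chain(2) ZD _ _ replete_epic_bottom replete_chn_le])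
    show "epic_bottom C n \<subseteq> Obj (chn C)" "chn_le C (n - 1) \<subseteq> Obj (chn C)"
      by (auto simp: epic_bottom_def chn_le_def)
    fix A B f assume *: "A \<in> epic_bottom C n" "B \<in> chn_le C (n - 1)" "f \<in> hom (chn C) A B"
    note f' = chn_homD[OF *(3)]
    note dA = chain_complexD(2)[OF f'(1)] and dB = chain_complexD(2)[OF f'(2)]
    have "zero_obj C (ob B n)" using *(2) by (simp add: chn_le_def)
    then have "bd B n \<cdot> cmp f n = zero_map C (ob A n) (ob B (n - 1))"
      using hom_zero_obj[OF f'(3)[of n]] comp_zero[OF chain_complexD(1)[OF f'(1)] dB] by simp
    then have "cmp f (n - 1) = zero_map C (ob A (n - 1)) (ob B (n - 1))"
      using zero_cancel_epic[OF _ dA f'(3)] f'(4)[of n] *(1) by (simp add: epic_bottom_def)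
    moreover have "zero_obj C (ob A i) \<or> zero_obj C (ob B i) \<or> i = n - 1" for i
      using *(1,2) by (cases "i < n - 1") (auto simp: epic_bottom_def chn_le_def)
    ultimately show "f = zero_map (chn C) A B" using chn_eq_zeroI[OF *(3)] by metis
  next
    fix M assume M: "M \<in> Obj (chn C)" "M \<in> D"
    then have MC: "chain_complex C M" and MP: "proper_chain C M" using D by simp_all
    note d = chain_complexD(2)[OF MC]
    obtain e m I where em: "e \<in> hom C (ob M n) I" "m \<in> hom C I (ob M (n - 1))" "bd M n = m \<cdot> e"
      "normal_epi C e" "epic C e" "normal_mono C m" "monic C m"
      using proper_arrowE[OF _ d[of n]] MP unfolding proper_chain_iff by metis
    obtain c where se: "short_exact C m c" using normal_mono_short_exact[OF em(6,2)] by blast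
    have cok: "is_cokernel C m c" using se short_exact_def by metis
    note Q = is_cokernelD[OF cok em(2)]
    have "(bd M (n - 1) \<cdot> m) \<cdot> e = zero_map C (ob M n) (ob M (n - 1 - 1))"
      using Comp_assoc[OF em(1,2) d[of "n - 1"]] em(3) bd_bd[OF MC, of "n - 1"] by simp
    then have dk: "bd M (n - 1) \<cdot> m = zero_map C I (ob M (n - 1 - 1))"
      using zero_cancel_epic[OF em(5,1) Comp_hom[OF em(2) d]] by blast
    have pd: "c \<cdot> bd M (n - 1 + 1) = zero_map C (ob M (n - 1 + 1)) (Cod C c)"
      using em(3) Comp_assoc[OF em(1,2) Q(1)] Q(2) zero_comp[OF _ em(1)] hom_Obj[OF Q(1)] by simp
    obtain A B k p where *: "k \<in> hom (chn C) A M" "p \<in> hom (chn C) M B" "short_exact (chn C) k p"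
      "\<forall>i<n - 1. zero_obj C (ob A i)" "\<forall>i>n - 1. zero_obj C (ob B i)"
      "cmp k (n - 1) = m" "cmp k (n - 1 + 1) = Idn C (ob M (n - 1 + 1))"
      "proper_chain C M \<longrightarrow> proper_chain C A \<and> proper_chain C B"
      using ex_good_truncation[OF MC se em(2) Q(1) dk pd] by auto
    note k' = chn_homD[OF *(1)]
    have kn: "cmp k n = Idn C (ob M n)" using *(7) by simp
    have AI: "ob A (n - 1) = I" using k'(3)[of "n - 1"] *(6) homD[OF em(2)] by (simp add: hom_def)
    have "ob A n = ob M n"
      using k'(3)[of n] kn homD[OF Idn_hom[OF chain_complexD(1)[OF MC, of n]]] by (simp add: hom_def)
    then have dA: "bd A n \<in> hom C (ob M n) I" using chain_complexD(2)[OF k'(1), of n] AI by simp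
    have "m \<cdot> bd A n = m \<cdot> e" using k'(4)[of n] *(6) kn Comp_Idn[OF d[of n]] em(3) by simp
    then have "bd A n = e" using monicD[OF em(7,2) dA em(1)] by blast
    then have "A \<in> epic_bottom C n \<inter> D" "B \<in> chn_le C (n - 1) \<inter> D"
      using * k'(1) chn_homD(2)[OF *(2)] D MP em(5) by (auto simp: epic_bottom_def chn_le_def)
    then show "\<exists>A \<in> epic_bottom C n \<inter> D. \<exists>B \<in> chn_le C (n - 1) \<inter> D.
        \<exists>k \<in> hom (chn C) A M. \<exists>p \<in> hom (chn C) M B. short_exact (chn C) k p"
      using *(1-3) by blast
  qed
  then show ?thesis unfolding pch_Obj D by (simp add: pch_def)
qed

end

section \<open>The coskeleton unit and the kernel of cotruncation\<close>

context pointed_category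
begin

lemma monic_to_zero_iff:
  assumes "A \<in> Obj C"
  shows "monic C (zero_map C A (Zero C)) \<longleftrightarrow> zero_obj C A"
proof
  note h = zero_map_hom[OF assms zero_obj_Obj[OF Zero_zero]]
  show "zero_obj C A" if "monic C (zero_map C A (Zero C))"
    using zero_obj_monic[OF that h Zero_zero] .
  show "monic C (zero_map C A (Zero C))" if "zero_obj C A"
    using monicI[OF h] zero_obj_hom_eq(1)[OF that] by blast
qed

lemma zero_obj_of_epic_zero:
  assumes "A \<in> Obj C" "B \<in> Obj C" "epic C (zero_map C A B)"
  shows "zero_obj C B"
proof -
  note h = zero_map_hom[OF assms(1,2)]
  have "Idn C B = zero_map C B B"
    using epicD[OF assms(3) h Idn_hom[OF assms(2)] zero_map_hom[OF assms(2,2)]]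
      Idn_Comp[OF h] zero_comp[OF assms(2) h] by simp
  then show ?thesis using zero_obj_iff_Idn assms(2) by blast
qed

text \<open>The identity and the degreewise zero map are both endomorphisms of \<open>W\<close>, which has only one.\<close>

lemma zero_obj_full_subcat_chn:
  assumes "zero_obj (full_subcat (chn C) D) W"
  shows "zero_obj C (ob W i)"
proof -
  have W: "chain_complex C W" "W \<in> D" using assms unfolding zero_obj_def by simp_all
  have "\<exists>!f. f \<in> hom (chn C) W W" using assms W unfolding zero_obj_def by auto
  moreover interpret Ch: category "chn C" by (rule category_chn)
  have "Idn (chn C) W \<in> hom (chn C) W W" using Ch.Idn_hom W by simp
  ultimately have "Idn (chn C) W = ChainMap W (\<lambda>i. zero_map C (ob W i) (ob W i)) W"
    using zero_chain_map_hom[OF W(1) W(1)] by blast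
  then have "Idn C (ob W i) = zero_map C (ob W i) (ob W i)"
    by (metis cmp_Idn chain_map.sel(2))
  then show ?thesis using zero_obj_iff_Idn chain_complexD(1)[OF W(1)] by blast
qed

end

context barr_exact_pointed
begin

text \<open>The unit is the identity below degree \<open>n\<close>, is an arrow to zero above degree \<open>n\<close>, and in degree \<open>n\<close> is \<open>\<delta>\<^sub>n\<close>
  followed back through the monomorphism \<open>ker \<delta>\<^bsub>n-1\<^esub>\<close>, hence monic together with \<open>\<delta>\<^sub>n\<close>.\<close>

lemma F_tr_eq: "F_tr C (n - 1) = monic_top C n"
proof -
  have "monic (chn C) (cosk_unit C (n - 1) M) \<longleftrightarrow>
      (\<forall>i>n. zero_obj C (ob M i)) \<and> monic C (bd M n)" if M: "chain_complex C M" for M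
  proof -
    note d = chain_complexD(2)[OF M] and d1 = chain_complexD(3)[OF M] and MO = chain_complexD(1)[OF M]
    note Z = Zero_zero
    note ZO = zero_obj_Obj[OF Z]
    define k where "k = ker C (bd M (n - 1))"
    define K where "K = Dom C k"
    have ker: "is_kernel C (bd M (n - 1)) k" unfolding k_def using ker_kernel[OF d] .
    note kk = is_kernelD[OF ker d, folded K_def]
    have KO: "K \<in> Obj C" using kk(1) hom_Obj by blast
    define W where "W = cosk C (n - 1) (tr C (n - 1) M)"
    define a where "a i = (if i \<le> n - 1 then Idn C (ob M i)
      else if i = n then (THE u. u \<in> hom C (ob M n) K \<and> k \<cdot> u = bd M n)
      else zero_map C (ob M i) (Zero C))" for i
    have unit: "cosk_unit C (n - 1) M = ChainMap M a W"
      unfolding cosk_unit_def W_def a_def k_def K_def Let_def by (simp add: fun_eq_iff)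
    have obW: "ob W i = (if i \<le> n - 1 then ob M i else if i = n then K else Zero C)" for i
      unfolding W_def cosk_def tr_def extend_by_zero_def k_def K_def Let_def by auto
    have bdW: "bd W i = (if i \<le> n - 1 then bd M i else if i = n then k
      else zero_map C (ob W i) (ob W (i - 1)))" for i
      unfolding W_def cosk_def tr_def extend_by_zero_def k_def K_def Let_def by auto
    have WO: "ob W i \<in> Obj C" for i unfolding obW using MO KO ZO by simp
    have hW: "bd W i \<in> hom C (ob W i) (ob W (i - 1))" for i
    proof -
      consider "i \<le> n - 1" | "i = n" | "i > n" by linarith
      then show ?thesis
      proof cases
        case 1 then show ?thesis using d by (simp add: bdW obW)
      next
        case 2 then show ?thesis using kk(1) by (simp add: bdW obW)
      next
        case 3 then show ?thesis using zero_map_hom[OF WO WO, of i "i - 1"] by (simp add: bdW)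
      qed
    qed
    have W: "chain_complex C W"
    proof (rule chain_complexI[OF hW])
      fix i
      consider "i < n - 1" | "i = n - 1" | "i \<ge> n" by linarith
      then show "bd W i \<cdot> bd W (i + 1) = zero_map C (ob W (i + 1)) (ob W (i - 1))"
      proof cases
        case 1 then show ?thesis using bd_bd[OF M, of i] by (simp add: bdW obW)
      next
        case 2 then show ?thesis using kk(2) by (simp add: bdW obW)
      next
        case 3
        then have "bd W (i + 1) = zero_map C (ob W (i + 1)) (ob W i)" by (simp add: bdW)
        then show ?thesis using comp_zero[OF WO hW] by simp
      qed
    qed
    obtain u where u: "u \<in> hom C (ob M n) K" "k \<cdot> u = bd M n"
    proof -
      have "bd M (n - 1) \<cdot> bd M n = zero_map C (ob M n) (ob M (n - 1 - 1))"
        using bd_bd[OF M, of "n - 1"] by simp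
      then show ?thesis using kk(4)[OF d[of n]] that by blast
    qed
    have "(THE u. u \<in> hom C (ob M n) K \<and> k \<cdot> u = bd M n) = u"
    proof (rule the_equality)
      show "u \<in> hom C (ob M n) K \<and> k \<cdot> u = bd M n" using u by blast
      show "v = u" if "v \<in> hom C (ob M n) K \<and> k \<cdot> v = bd M n" for v
        using monicD[OF kk(3,1) conjunct1[OF that] u(1)] that u(2) by simp
    qed
    then have a: "a i = (if i \<le> n - 1 then Idn C (ob M i) else if i = n then u
      else zero_map C (ob M i) (Zero C))" for i
      by (simp add: a_def)
    have ha: "a i \<in> hom C (ob M i) (ob W i)" for i
      using u(1) Idn_hom[OF MO] zero_map_hom[OF MO ZO] by (simp add: a obW)
    have h: "ChainMap M a W \<in> hom (chn C) M W"
    proof (rule chn_homI[OF M W ha])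
      fix i
      consider "i \<le> n - 1" | "i = n" | "i = n + 1" | "i > n + 1" by linarith
      then show "a (i - 1) \<cdot> bd M i = bd W i \<cdot> a i"
      proof cases
        case 1 then show ?thesis using Idn_Comp[OF d[of i]] Comp_Idn[OF d[of i]] by (simp add: a bdW)
      next
        case 2 then show ?thesis using Idn_Comp[OF d[of n]] u(2) by (simp add: a bdW)
      next
        case 3
        have "k \<cdot> (u \<cdot> bd M (n + 1)) = zero_map C (ob M (n + 1)) (ob M (n - 1))"
          using Comp_assoc[OF d1 u(1) kk(1)] u(2) bd_bd[OF M, of n] by simp
        then have "u \<cdot> bd M (n + 1) = zero_map C (ob M (n + 1)) K"
          using zero_cancel_monic[OF kk(3) _ Comp_hom[OF d1 u(1)]] kk(1) by simp
        moreover have "bd W i = zero_map C (ob W i) (ob W (i - 1))" using 3 by (simp add: bdW)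
        ultimately show ?thesis using zero_comp[OF WO[of "i - 1"] ha[of i]] 3 by (simp add: a obW)
      next
        case 4
        then have "bd W i = zero_map C (ob W i) (ob W (i - 1))"
          and "a (i - 1) = zero_map C (ob M (i - 1)) (ob W (i - 1))" by (simp_all add: bdW a obW)
        then show ?thesis using zero_comp[OF WO ha] zero_comp[OF WO d] by simp
      qed
    qed
    have um: "monic C u \<longleftrightarrow> monic C (bd M n)"
      using monic_comp_cancel[OF _ u(1) kk(1)] monic_comp[OF kk(3) _ u(1) kk(1)] u(2) by auto
    have "monic (chn C) (ChainMap M a W) \<longleftrightarrow> (\<forall>i. monic C (a i))"
      using monic_chn_cmp[OF _ h] monic_chnI[OF h] by auto
    also have "\<dots> \<longleftrightarrow> (\<forall>i>n. zero_obj C (ob M i)) \<and> monic C u"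
    proof
      assume A: "\<forall>i. monic C (a i)"
      have "zero_obj C (ob M i)" if "i > n" for i
        using A[rule_format, of i] that monic_to_zero_iff[OF MO] by (simp add: a)
      moreover have "monic C u" using A[rule_format, of n] by (simp add: a)
      ultimately show "(\<forall>i>n. zero_obj C (ob M i)) \<and> monic C u" by blast
    next
      assume "(\<forall>i>n. zero_obj C (ob M i)) \<and> monic C u"
      then show "\<forall>i. monic C (a i)" using Idn_monic[OF MO] monic_to_zero_iff[OF MO] by (simp add: a)
    qed
    finally show ?thesis using um unit by simp
  qed
  then show ?thesis unfolding F_tr_def monic_top_def by auto
qed

end

context semi_abelian
begin

text \<open>The cokernel of \<open>d = m \<cdot> e\<close> is that of \<open>m\<close>, and \<open>m\<close> is the kernel of its cokernel. If the latter is zero, the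
  identity factors through \<open>m\<close>.\<close>

lemma proper_arrow_cokernel:
  assumes "proper_arrow C d" "d \<in> hom C A B"
  shows "\<exists>c. is_cokernel C d c"
    and "\<lbrakk>is_cokernel C d c; zero_obj C (Cod C c)\<rbrakk> \<Longrightarrow> epic C d"
proof -
  obtain e m I where em: "e \<in> hom C A I" "m \<in> hom C I B" "d = m \<cdot> e" "normal_epi C e" "epic C e"
    "normal_mono C m" "monic C m"
    using proper_arrowE[OF assms] by metis
  obtain q where se: "short_exact C m q" using normal_mono_short_exact[OF em(6,2)] by blast
  have cok: "is_cokernel C m q" and ker: "is_kernel C q m" using se short_exact_def by metis+
  note Q = is_cokernelD[OF cok em(2)]
  note K = is_kernelD[OF ker Q(1), unfolded homD[OF em(2)]]
  have qd: "q \<cdot> d = zero_map C A (Cod C q)"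
    using em(3) Comp_assoc[OF em(1,2) Q(1)] Q(2) zero_comp[OF _ em(1)] hom_Obj[OF Q(1)] by simp
  have "is_cokernel C d q"
  proof (rule is_cokernelI[OF assms(2) Q(1) qd Q(3)])
    fix D h assume h: "h \<in> hom C B D" "h \<cdot> d = zero_map C A D"
    then have "h \<cdot> m = zero_map C I D"
      using zero_cancel_epic[OF em(5,1) Comp_hom[OF em(2) h(1)]] Comp_assoc[OF em(1,2) h(1)] em(3) by simp
    then show "\<exists>u \<in> hom C (Cod C q) D. u \<cdot> q = h" using Q(4) h(1) by blast
  qed
  then show "\<exists>c. is_cokernel C d c" by blast
  assume c: "is_cokernel C d c" "zero_obj C (Cod C c)"
  note c' = is_cokernelD[OF c(1) assms(2)]
  obtain t where t: "t \<in> hom C (Cod C c) (Cod C q)" "t \<cdot> c = q" using c'(4)[OF Q(1) qd] by blast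
  have B: "B \<in> Obj C" using assms hom_Obj by blast
  have "q = zero_map C B (Cod C q)"
    using t hom_zero_obj[OF c'(1)] c(2) comp_zero[OF B t(1)] by simp
  then have "q \<cdot> Idn C B = zero_map C B (Cod C q)" using Comp_Idn[OF Q(1)] by simp
  then obtain s where s: "s \<in> hom C B I" "m \<cdot> s = Idn C B" using K(4)[OF Idn_hom[OF B]] by blast
  then have "epic C m" using retraction_epic em(2) by blast
  then show "epic C d" using epic_comp[OF _ em(5,1,2)] em(3) by simp
qed

lemma Ker_cot_proper_iff:
  assumes P: "proper_chain C M"
  shows "M \<in> Ker_cot C (n - 1) \<longleftrightarrow> M \<in> epic_bottom C n"
proof -
  have M: "chain_complex C M" and pa: "proper_arrow C (bd M n)" using P by (simp_all add: proper_chain_iff)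
  note d = chain_complexD(2)[OF M] and MO = chain_complexD(1)[OF M]
  note Z = Zero_zero
  note ZO = zero_obj_Obj[OF Z]
  define c where "c = coker C (bd M n)"
  define Q where "Q = Cod C c"
  have cok: "is_cokernel C (bd M n) c"
    unfolding c_def coker_def using proper_arrow_cokernel(1)[OF pa d] by (rule someI_ex)
  note cc = is_cokernelD[OF cok d, folded Q_def]
  have QO: "Q \<in> Obj C" using cc(1) hom_Obj by blast
  define W where "W = cot C (n - 1) M"
  have obW: "ob W i = (if i = n - 1 then Q else if i < n - 1 then ob M i else Zero C)" for i
    unfolding W_def cot_def extend_by_zero_def c_def Q_def Let_def by auto
  have WO: "ob W i \<in> Obj C" for i unfolding obW using MO QO ZO by simp
  have K: "M \<in> Ker_cot C (n - 1) \<longleftrightarrow> zero_obj (full_subcat (chn C) (chn_le C (n - 1))) W"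
    using M by (simp add: Ker_cot_def W_def)
  show ?thesis
  proof
    assume "M \<in> Ker_cot C (n - 1)"
    then have z: "zero_obj C (ob W i)" for i using K zero_obj_full_subcat_chn by blast
    have "zero_obj C Q" using z[of "n - 1"] by (simp add: obW)
    then have "epic C (bd M n)" using proper_arrow_cokernel(2)[OF pa d cok] Q_def by simp
    moreover have "zero_obj C (ob M i)" if "i < n - 1" for i using z[of i] that by (simp add: obW)
    ultimately show "M \<in> epic_bottom C n" using M by (simp add: epic_bottom_def)
  next
    assume E: "M \<in> epic_bottom C n"
    then have e: "epic C (bd M n)" by (simp add: epic_bottom_def)
    have "c = zero_map C (ob M (n - 1)) Q"
      using zero_cancel_epic[OF e d cc(1)] cc(2) by simp
    then have zQ: "zero_obj C Q" using zero_obj_of_epic_zero[OF MO QO] cc(3) by simp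
    have z: "zero_obj C (ob W i)" for i using E zQ Z by (simp add: obW epic_bottom_def)
    obtain u where u: "u \<in> hom C Q (ob M (n - 1 - 1))" "u \<cdot> c = bd M (n - 1)"
    proof -
      have "bd M (n - 1) \<cdot> bd M n = zero_map C (ob M n) (ob M (n - 1 - 1))"
        using bd_bd[OF M, of "n - 1"] by simp
      then show ?thesis using cc(4)[OF d[of "n - 1"]] that by blast
    qed
    have T: "(THE u. u \<in> hom C Q (ob M (n - 1 - 1)) \<and> u \<cdot> c = bd M (n - 1)) = u"
    proof (rule the_equality)
      show "u \<in> hom C Q (ob M (n - 1 - 1)) \<and> u \<cdot> c = bd M (n - 1)" using u by blast
      show "v = u" if "v \<in> hom C Q (ob M (n - 1 - 1)) \<and> v \<cdot> c = bd M (n - 1)" for v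
        using epicD[OF cc(3,1) conjunct1[OF that] u(1)] that u(2) by simp
    qed
    have bdW: "bd W i = (if i = n - 1 then u else if i < n - 1 then bd M i
        else zero_map C (ob W i) (ob W (i - 1)))" for i
      using T unfolding W_def cot_def extend_by_zero_def c_def Q_def Let_def by auto
    have hW: "bd W i \<in> hom C (ob W i) (ob W (i - 1))" for i
    proof -
      consider "i = n - 1" | "i < n - 1" | "i > n - 1" by linarith
      then show ?thesis
      proof cases
        case 1 then show ?thesis using u(1) by (simp add: bdW obW)
      next
        case 2 then show ?thesis using d by (simp add: bdW obW)
      next
        case 3 then show ?thesis using zero_map_hom[OF WO WO, of i "i - 1"] by (simp add: bdW)
      qed
    qed
    have W: "chain_complex C W"
    proof (rule chain_complexI[OF hW])
      fix i
      have "bd W (i + 1) \<in> hom C (ob W (i + 1)) (ob W i)" using hW[of "i + 1"] by simp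
      then show "bd W i \<cdot> bd W (i + 1) = zero_map C (ob W (i + 1)) (ob W (i - 1))"
        using hom_zero_obj[OF Comp_hom[OF _ hW]] z by blast
    qed
    interpret Ch: pointed_category "chn C" by (rule pointed_chn)
    have "W \<in> chn_le C (n - 1)" using W z by (simp add: chn_le_def)
    then show "M \<in> Ker_cot C (n - 1)"
      using K Ch.zero_obj_full_subcat zero_obj_chnI[OF W z] by blast
  qed
qed

end

lemma pch_le_eq: "pch_le C n = chn_le C n \<inter> {M. proper_chain C M}"
  and pch_ge_eq: "pch_ge C n = chn_ge C n \<inter> {M. proper_chain C M}"
  and MN_eq: "MN C n = monic_top C n \<inter> {M. proper_chain C M}"
  and EP_eq: "EP C n = epic_bottom C n \<inter> {M. proper_chain C M}"
  by (auto simp: pch_le_def pch_ge_def MN_def EP_def pch_Obj chn_le_def chn_ge_def monic_top_def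
      epic_bottom_def proper_chain_iff)

theorem corollary6p4:
  fixes X :: "('o, 'm) cat" and n :: int
  assumes "semi_abelian X"
  shows "ttf_theory (chn X) (chn_le X (n - 1), chn_ge X n, F_tr X (n - 1)) \<and>
    restriction (pch X) (chn_le X (n - 1), chn_ge X n, F_tr X (n - 1)) =
      (pch_le X (n - 1), pch_ge X n, MN X n) \<and>
    ttf_theory (pch X) (pch_le X (n - 1), pch_ge X n, MN X n) \<and>
    restriction (pch X) (Ker_cot X (n - 1), chn_le X (n - 1), chn_ge X n) =
      (EP X n, pch_le X (n - 1), pch_ge X n) \<and>
    ttf_theory (pch X) (EP X n, pch_le X (n - 1), pch_ge X n)"
proof -
  interpret semi_abelian X by (rule assms)
  note eqs = pch_le_eq pch_ge_eq MN_eq EP_eq F_tr_eq pch_Obj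
  have "ttf_theory (chn X) (chn_le X (n - 1), chn_ge X n, F_tr X (n - 1))"
    using torsion_le_ge[of UNIV n] torsion_ge_monic_top[of UNIV n] by (simp add: ttf_theory_def eqs)
  moreover have "ttf_theory (pch X) (pch_le X (n - 1), pch_ge X n, MN X n)"
    "ttf_theory (pch X) (EP X n, pch_le X (n - 1), pch_ge X n)"
    using torsion_le_ge[OF disjI2, OF refl, of n] torsion_ge_monic_top[OF disjI2, OF refl, of n]
      torsion_epic_bottom_le[of n, unfolded pch_Obj]
    by (simp_all add: ttf_theory_def eqs pch_def)
  moreover have "Ker_cot X (n - 1) \<inter> Obj (pch X) = EP X n"
    using Ker_cot_proper_iff by (auto simp: eqs)
  ultimately show ?thesis by (simp add: restriction_def eqs)
qed

end
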